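(* There is an algorithm which takes as input a finite biordered set $\mathcal{E}$ (with underlying set $E$) and a word $w\in E^*$, and decides whether $w$ represents a regular element of $\mathsf{IG}(\mathcal{E})$, and if so, returns $e,f\in E$ such that $e\ \mathscr{R}\ w\ \mathscr{L}\ f$ in $\mathsf{IG}(\mathcal{E})$.
   Context: For a semigroup $S$ with set of idempotents $E=E(S)$, a pair $(e,f)\in E\times E$ is a basic pair if $\{e,f\}\cap\{ef,fe\}\neq\varnothing$ (products in $S$); then $ef$ is again an idempotent. The biordered set of $S$ is the partial algebra $\mathcal{E}=(E,* )$ in which $e*f=ef$ if $(e,f)$ is a basic pair, and $e*f$ is undefined otherwise. A biordered set is a partial algebra arising in this way from some semigroup (not necessarily finite, even if $E$ is finite); a finite biordered set is given to an algorithm by its partial multiplication table. The free idempotent generated semigroup over $\mathcal{E}$ is the semigroup given by the presentation $\mathsf{IG}(\mathcal{E})=\langle E\mid ef=e*f\ ((e,f)\text{ a basic pair})\rangle$, where $ef$ is the word of length 2 and $e*f$ is a single letter. The idempotents of $\mathsf{IG}(\mathcal{E})$ are exactly the elements represented by the letters $e\in E$, and distinct letters represent distinct elements. $E^*$ is the set of all words over $E$ (the empty word represents no element of the semigroup). Green's relations $\mathscr{R},\mathscr{L}$ between words refer to the elements of $\mathsf{IG}(\mathcal{E})$ they represent. An element $a$ of a semigroup is regular if $aa'a=a$ for some $a'$. *)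

theory Defs
  imports Main "HOL-Library.Nat_Bijection" "HOL-Library.Countable_Set"
begin

section \<open>Semigroups on a carrier set\<close>

definition semigroup_on :: "'a set \<Rightarrow> ('a \<Rightarrow> 'a \<Rightarrow> 'a) \<Rightarrow> bool" where
  "semigroup_on S m \<longleftrightarrow>
     (\<forall>x\<in>S. \<forall>y\<in>S. m x y \<in> S) \<and>
     (\<forall>x\<in>S. \<forall>y\<in>S. \<forall>z\<in>S. m (m x y) z = m x (m y z))"

definition idempotents :: "'a set \<Rightarrow> ('a \<Rightarrow> 'a \<Rightarrow> 'a) \<Rightarrow> 'a set" where
  "idempotents S m = {e \<in> S. m e e = e}"

definition regular_element :: "'a set \<Rightarrow> ('a \<Rightarrow> 'a \<Rightarrow> 'a) \<Rightarrow> 'a \<Rightarrow> bool" where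
  "regular_element S m a \<longleftrightarrow> a \<in> S \<and> (\<exists>a'\<in>S. m (m a a') a = a)"

text \<open>Green's relations: \<open>a\<close> and \<open>b\<close> generate the same principal right
  (respectively left) ideal; the ideals are \<open>a S\<^sup>1\<close> and \<open>S\<^sup>1 a\<close>.\<close>

definition green_R :: "'a set \<Rightarrow> ('a \<Rightarrow> 'a \<Rightarrow> 'a) \<Rightarrow> 'a \<Rightarrow> 'a \<Rightarrow> bool" where
  "green_R S m a b \<longleftrightarrow> a \<in> S \<and> b \<in> S \<and>
     insert a ((\<lambda>s. m a s) ` S) = insert b ((\<lambda>s. m b s) ` S)"

definition green_L :: "'a set \<Rightarrow> ('a \<Rightarrow> 'a \<Rightarrow> 'a) \<Rightarrow> 'a \<Rightarrow> 'a \<Rightarrow> bool" where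
  "green_L S m a b \<longleftrightarrow> a \<in> S \<and> b \<in> S \<and>
     insert a ((\<lambda>s. m s a) ` S) = insert b ((\<lambda>s. m s b) ` S)"


section \<open>Biordered sets\<close>

definition basic_pair :: "('a \<Rightarrow> 'a \<Rightarrow> 'a) \<Rightarrow> 'a \<Rightarrow> 'a \<Rightarrow> bool" where
  "basic_pair m e f \<longleftrightarrow> {e, f} \<inter> {m e f, m f e} \<noteq> {}"

lemma basic_pair_iff:
  "basic_pair m e f \<longleftrightarrow> e = m e f \<or> e = m f e \<or> f = m e f \<or> f = m f e"
  by (auto simp: basic_pair_def)

definition biorder_op :: "'a set \<Rightarrow> ('a \<Rightarrow> 'a \<Rightarrow> 'a) \<Rightarrow> 'a \<Rightarrow> 'a \<Rightarrow> 'a option" where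
  "biorder_op S m e f =
     (if e \<in> idempotents S m \<and> f \<in> idempotents S m \<and> basic_pair m e f
      then Some (m e f) else None)"

text \<open>A finite biordered set of size \<open>n\<close> is represented with underlying set \<open>{..<n}\<close>,
  its partial operation being \<open>None\<close> where undefined. The semigroup it comes from may be
  infinite. Restricting it to carriers that are sets of natural numbers loses no generality;
  see \<open>finite_biordered_set_transport\<close> below.\<close>

definition finite_biordered_set :: "nat \<Rightarrow> (nat \<Rightarrow> nat \<Rightarrow> nat option) \<Rightarrow> bool" where
  "finite_biordered_set n star \<longleftrightarrow>
     (\<exists>(S :: nat set) m. semigroup_on S m \<and> idempotents S m = {..<n} \<and> star = biorder_op S m)"

inductive_set generated :: "('a \<Rightarrow> 'a \<Rightarrow> 'a) \<Rightarrow> 'a set \<Rightarrow> 'a set" for m E where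
  gen: "x \<in> E \<Longrightarrow> x \<in> generated m E"
| mult: "x \<in> generated m E \<Longrightarrow> y \<in> generated m E \<Longrightarrow> m x y \<in> generated m E"

lemma generated_subset:
  assumes "semigroup_on S m" "E \<subseteq> S" shows "generated m E \<subseteq> S"
proof
  fix x assume "x \<in> generated m E"
  then show "x \<in> S"
    by induction (use assms in \<open>auto simp: semigroup_on_def\<close>)
qed

lemma countable_generated:
  assumes "semigroup_on S m" "E \<subseteq> S" "countable E" shows "countable (generated m E)"
proof -
  define f where "f = (\<lambda>w. foldr m (butlast w) (last w))"
  have mem: "foldr m u x \<in> S" if "set u \<subseteq> E" "x \<in> S" for u x
    using that assms(1,2) by (induction u) (auto simp: semigroup_on_def)
  have mm: "m (foldr m u x) y = foldr m u (m x y)" if "set u \<subseteq> E" "x \<in> S" "y \<in> S" for u x y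
    using that
  proof (induction u)
    case (Cons a u)
    then have "a \<in> S" "foldr m u x \<in> S" using assms(2) mem by auto
    with Cons show ?case using assms(1) by (simp add: semigroup_on_def)
  qed simp
  have "\<exists>w\<in>lists E. w \<noteq> [] \<and> x = f w" if "x \<in> generated m E" for x
    using that
  proof induction
    case (gen x)
    then show ?case by (intro bexI[of _ "[x]"]) (auto simp: f_def)
  next
    case (mult x y)
    then obtain u v where uv: "u \<in> lists E" "u \<noteq> []" "x = f u" "v \<in> lists E" "v \<noteq> []" "y = f v"
      by blast
    have y: "y \<in> S" using mult.hyps generated_subset[OF assms(1,2)] by blast
    have lu: "last u \<in> E" "set (butlast u) \<subseteq> E"
      using uv(1,2) in_set_butlastD[of _ u] last_in_set[OF uv(2)] by auto
    have "m x y = foldr m (butlast u) (m (last u) y)"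
      using mm[OF lu(2) _ y] lu assms(2) uv(3) by (auto simp: f_def)
    also have "\<dots> = foldr m u y"
      by (subst (3) append_butlast_last_id[OF uv(2), symmetric]) simp
    also have "\<dots> = f (u @ v)"
      using uv(5,6) by (simp add: f_def butlast_append)
    finally show ?case using uv by (intro bexI[of _ "u @ v"]) auto
  qed
  then have "generated m E \<subseteq> f ` lists E" by blast
  then show ?thesis
    by (rule countable_subset) (use assms(3) in \<open>simp add: countable_lists\<close>)
qed

text \<open>Whatever the type and cardinality of a semigroup with finitely many idempotents, its
  biordered set, transported along any numbering of the idempotents, satisfies
  \<open>finite_biordered_set\<close>: the subsemigroup generated by the idempotents is countable and has
  the same biordered set.\<close>

lemma finite_biordered_set_transport:
  fixes S :: "'a set"
  assumes sg: "semigroup_on S m" and bij: "bij_betw \<phi> {..<n} (idempotents S m)"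
  shows "finite_biordered_set n
    (\<lambda>i j. if i < n \<and> j < n
           then map_option (the_inv_into {..<n} \<phi>) (biorder_op S m (\<phi> i) (\<phi> j)) else None)"
proof -
  define E where "E = idempotents S m"
  define T where "T = generated m E"
  have ES: "E \<subseteq> S" by (auto simp: E_def idempotents_def)
  have TS: "T \<subseteq> S" unfolding T_def by (rule generated_subset[OF sg ES])
  have ET: "E \<subseteq> T" by (auto simp: T_def intro: generated.gen)
  have TT: "m x y \<in> T" if "x \<in> T" "y \<in> T" for x y
    using that by (auto simp: T_def intro: generated.mult)
  have idT: "idempotents T m = E" using TS ET by (auto simp: E_def idempotents_def)
  have bijE: "bij_betw \<phi> {..<n} E" using bij by (simp add: E_def)
  have "finite E" using bij_betw_finite[OF bijE] by simp
  then have cT: "countable T"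
    unfolding T_def by (intro countable_generated[OF sg ES]) (rule countable_finite)
  define \<psi> where "\<psi> = (\<lambda>x. if x \<in> E then the_inv_into {..<n} \<phi> x else n + to_nat_on T x)"
  have injphi: "inj_on \<phi> {..<n}" and imgphi: "\<phi> ` {..<n} = E"
    using bijE by (auto simp: bij_betw_def)
  have psiE: "\<psi> x < n" "\<phi> (\<psi> x) = x" if "x \<in> E" for x
    using that the_inv_into_into[OF injphi, of x "{..<n}"] f_the_inv_into_f[OF injphi, of x] imgphi
    by (auto simp: \<psi>_def)
  have psiphi: "\<psi> (\<phi> i) = i" if "i < n" for i
    using that the_inv_into_f_f[OF injphi, of i] imgphi by (auto simp: \<psi>_def)
  have phiE: "\<phi> i \<in> E" if "i < n" for i using that imgphi by auto
  have psiN: "\<not> \<psi> x < n" if "x \<notin> E" for x using that by (simp add: \<psi>_def)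
  have inj: "inj_on \<psi> T"
  proof (rule inj_onI)
    fix x y assume xy: "x \<in> T" "y \<in> T" "\<psi> x = \<psi> y"
    show "x = y"
    proof (cases "x \<in> E")
      case True
      then have "y \<in> E" using psiE(1)[OF True] psiN[of y] xy(3) by auto
      then show ?thesis using psiE(2) True xy(3) by metis
    next
      case False
      then have "y \<notin> E" using psiE(1)[of y] psiN[OF False] xy(3) by auto
      then show ?thesis using False xy cT inj_on_to_nat_on[OF cT]
        by (auto simp: \<psi>_def inj_on_def)
    qed
  qed
  define \<theta> where "\<theta> = the_inv_into T \<psi>"
  have th: "\<theta> (\<psi> x) = x" if "x \<in> T" for x
    using that inj by (simp add: \<theta>_def the_inv_into_f_f)
  have thphi: "\<theta> i = \<phi> i" if "i < n" for i
    using th[of "\<phi> i"] psiphi[OF that] phiE[OF that] ET by auto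
  define m' where "m' = (\<lambda>a b. \<psi> (m (\<theta> a) (\<theta> b)))"
  have m': "m' (\<psi> x) (\<psi> y) = \<psi> (m x y)" if "x \<in> T" "y \<in> T" for x y
    using that th by (simp add: m'_def)
  have sg': "semigroup_on (\<psi> ` T) m'"
    using sg TS TT m' unfolding semigroup_on_def by (simp add: subset_iff)
  have id': "idempotents (\<psi> ` T) m' = {..<n}"
  proof (intro set_eqI iffI)
    fix a assume "a \<in> idempotents (\<psi> ` T) m'"
    then obtain x where x: "x \<in> T" "a = \<psi> x" "\<psi> (m x x) = \<psi> x"
      using m' by (auto simp: idempotents_def)
    then have "m x x = x" using inj TT by (auto dest: inj_onD)
    then have "x \<in> E" using x(1) idT by (auto simp: idempotents_def)
    then show "a \<in> {..<n}" using psiE x(2) by auto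
  next
    fix a assume "a \<in> {..<n}"
    then have a: "a < n" by simp
    have "m (\<phi> a) (\<phi> a) = \<phi> a" using phiE[OF a] by (auto simp: E_def idempotents_def)
    then show "a \<in> idempotents (\<psi> ` T) m'"
      using m'[of "\<phi> a" "\<phi> a"] phiE[OF a] ET psiphi[OF a] by (force simp: idempotents_def)
  qed
  have "(if i < n \<and> j < n
         then map_option (the_inv_into {..<n} \<phi>) (biorder_op S m (\<phi> i) (\<phi> j)) else None)
       = biorder_op (\<psi> ` T) m' i j" for i j
  proof (cases "i < n \<and> j < n")
    case False
    then show ?thesis by (auto simp: biorder_op_def id')
  next
    case True
    then have ij: "\<phi> i \<in> E" "\<phi> j \<in> E" "\<phi> i \<in> T" "\<phi> j \<in> T" using phiE ET by auto
    have mij: "m' i j = \<psi> (m (\<phi> i) (\<phi> j))" "m' j i = \<psi> (m (\<phi> j) (\<phi> i))"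
      using True by (simp_all add: m'_def thphi)
    have eq: "\<psi> x = \<psi> y \<longleftrightarrow> x = y" if "x \<in> T" "y \<in> T" for x y
      using inj that by (auto dest: inj_onD)
    have key: "i = \<psi> (\<phi> i)" "j = \<psi> (\<phi> j)" using True psiphi by auto
    have bp: "basic_pair m' i j \<longleftrightarrow> basic_pair m (\<phi> i) (\<phi> j)"
    proof -
      have "i = \<psi> z \<longleftrightarrow> \<phi> i = z" "j = \<psi> z \<longleftrightarrow> \<phi> j = z" if "z \<in> T" for z
        using eq[OF ij(3) that] eq[OF ij(4) that] key by auto
      note this[OF TT[OF ij(3,4)]] this[OF TT[OF ij(4,3)]]
      then show ?thesis unfolding basic_pair_iff mij by simp
    qed
    have "m (\<phi> i) (\<phi> j) \<in> E" if bpm: "basic_pair m (\<phi> i) (\<phi> j)"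
    proof -
      define e f where "e = \<phi> i" and "f = \<phi> j"
      have ef: "e \<in> S" "f \<in> S" "m e e = e" "m f f = f"
        using ij by (auto simp: e_def f_def E_def idempotents_def)
      have as: "m (m x y) z = m x (m y z)" if "x \<in> S" "y \<in> S" "z \<in> S" for x y z
        using that sg by (auto simp: semigroup_on_def)
      have cl: "m x y \<in> S" if "x \<in> S" "y \<in> S" for x y
        using that sg by (auto simp: semigroup_on_def)
      have "m e f = e \<or> m e f = f \<or> m f e = e \<or> m f e = f"
        using bpm by (auto simp: basic_pair_def e_def f_def)
      moreover have 1: "m (m e f) (m e f) = m e (m (m f e) f)"
        using ef as cl by simp
      have 2: "m e (m e f) = m e f" using as[of e e f] ef by simp
      have "m (m e f) (m e f) = m e f" if "m f e = e" using 1 2 that by simp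
      moreover have "m (m e f) (m e f) = m e f" if "m f e = f" using 1 ef that by simp
      ultimately have "m (m e f) (m e f) = m e f"
        using ef by auto
      then show ?thesis using cl ef(1,2) by (simp add: E_def idempotents_def e_def f_def)
    qed
    then have "basic_pair m (\<phi> i) (\<phi> j) \<Longrightarrow>
        the_inv_into {..<n} \<phi> (m (\<phi> i) (\<phi> j)) = \<psi> (m (\<phi> i) (\<phi> j))"
      by (simp add: \<psi>_def)
    then show ?thesis
      using True ij by (simp add: biorder_op_def id' bp mij E_def)
  qed
  with sg' id' show ?thesis
    unfolding finite_biordered_set_def by blast
qed


section \<open>The free idempotent generated semigroup\<close>

text \<open>The congruence on the nonempty words over \<open>{..<n}\<close> generated by the defining relations
  of the presentation.\<close>

inductive ig_cong :: "nat \<Rightarrow> (nat \<Rightarrow> nat \<Rightarrow> nat option) \<Rightarrow> nat list \<Rightarrow> nat list \<Rightarrow> bool"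
  for n star where
  base: "e < n \<Longrightarrow> f < n \<Longrightarrow> g < n \<Longrightarrow> star e f = Some g \<Longrightarrow> ig_cong n star [e, f] [g]"
| refl: "u \<in> lists {..<n} \<Longrightarrow> u \<noteq> [] \<Longrightarrow> ig_cong n star u u"
| sym: "ig_cong n star u v \<Longrightarrow> ig_cong n star v u"
| trans: "ig_cong n star u v \<Longrightarrow> ig_cong n star v w \<Longrightarrow> ig_cong n star u w"
| mult: "ig_cong n star u u' \<Longrightarrow> ig_cong n star v v' \<Longrightarrow> ig_cong n star (u @ v) (u' @ v')"

definition ig_class :: "nat \<Rightarrow> (nat \<Rightarrow> nat \<Rightarrow> nat option) \<Rightarrow> nat list \<Rightarrow> nat list set" where
  "ig_class n star w = {v. ig_cong n star w v}"

definition ig_carrier :: "nat \<Rightarrow> (nat \<Rightarrow> nat \<Rightarrow> nat option) \<Rightarrow> nat list set set" where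
  "ig_carrier n star = {ig_class n star w | w. w \<in> lists {..<n} \<and> w \<noteq> []}"

definition ig_mult ::
  "nat \<Rightarrow> (nat \<Rightarrow> nat \<Rightarrow> nat option) \<Rightarrow> nat list set \<Rightarrow> nat list set \<Rightarrow> nat list set" where
  "ig_mult n star A B = (\<Union>u\<in>A. \<Union>v\<in>B. ig_class n star (u @ v))"

lemma ig_cong_words:
  "ig_cong n star u v \<Longrightarrow> u \<in> lists {..<n} \<and> u \<noteq> [] \<and> v \<in> lists {..<n} \<and> v \<noteq> []"
  by (induction rule: ig_cong.induct) auto

lemma ig_class_eq_iff:
  assumes "u \<in> lists {..<n}" "u \<noteq> []"
  shows "ig_class n star u = ig_class n star v \<longleftrightarrow> ig_cong n star u v"
  using assms unfolding ig_class_def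
  by (blast intro: ig_cong.refl ig_cong.sym ig_cong.trans)

lemma ig_mult_class:
  assumes "u \<in> lists {..<n}" "u \<noteq> []" "v \<in> lists {..<n}" "v \<noteq> []"
  shows "ig_mult n star (ig_class n star u) (ig_class n star v) = ig_class n star (u @ v)"
  using assms unfolding ig_mult_def ig_class_def
  by (blast intro: ig_cong.refl ig_cong.trans ig_cong.mult)

lemma semigroup_on_ig: "semigroup_on (ig_carrier n star) (ig_mult n star)"
proof -
  have mem: "ig_class n star w \<in> ig_carrier n star" if "w \<in> lists {..<n}" "w \<noteq> []" for w
    using that by (auto simp: ig_carrier_def)
  have ex: "\<exists>w. w \<in> lists {..<n} \<and> w \<noteq> [] \<and> x = ig_class n star w" if "x \<in> ig_carrier n star" for x
    using that by (auto simp: ig_carrier_def)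
  have app: "u @ v \<in> lists {..<n}" "u @ v \<noteq> []"
    if "u \<in> lists {..<n}" "u \<noteq> []" "v \<in> lists {..<n}" for u v :: "nat list"
    using that by auto
  show ?thesis
    unfolding semigroup_on_def
  proof (intro conjI ballI)
    fix x y assume "x \<in> ig_carrier n star" "y \<in> ig_carrier n star"
    then obtain u v where "u \<in> lists {..<n}" "u \<noteq> []" "x = ig_class n star u"
      "v \<in> lists {..<n}" "v \<noteq> []" "y = ig_class n star v" using ex by metis
    then show "ig_mult n star x y \<in> ig_carrier n star"
      using mem[of "u @ v"] app[of u v] by (metis ig_mult_class)
  next
    fix x y z
    assume "x \<in> ig_carrier n star" "y \<in> ig_carrier n star" "z \<in> ig_carrier n star"
    then obtain u v w where uvw: "u \<in> lists {..<n}" "u \<noteq> []" "x = ig_class n star u"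
      "v \<in> lists {..<n}" "v \<noteq> []" "y = ig_class n star v"
      "w \<in> lists {..<n}" "w \<noteq> []" "z = ig_class n star w" using ex by metis
    then show "ig_mult n star (ig_mult n star x y) z = ig_mult n star x (ig_mult n star y z)"
      by (simp only: ig_mult_class app append_assoc not_False_eq_True)
  qed
qed

text \<open>The empty word represents no element.\<close>

lemma ig_class_Nil: "ig_class n star [] \<notin> ig_carrier n star"
proof -
  have "ig_class n star [] = {}" using ig_cong_words by (fastforce simp: ig_class_def)
  moreover have "w \<in> ig_class n star w" if "w \<in> lists {..<n}" "w \<noteq> []" for w
    using that by (simp add: ig_class_def ig_cong.refl)
  ultimately show ?thesis by (force simp: ig_carrier_def)
qed


section \<open>Algorithms: partial recursive functions\<close>

text \<open>Algorithms are the partial recursive functions of Kleene on tuples of natural numbers;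
  \<open>None\<close> means that the computation does not terminate or that the arity is wrong.\<close>

datatype recf =
    Zero
  | Succ
  | Proj nat
  | Comp recf "recf list"
  | PrimRec recf recf
  | Mu recf

text \<open>\<open>PrimRec f g\<close> recurses on the first argument, \<open>g\<close> being applied to the counter, the
  previous value and the parameters. \<open>Mu f\<close> searches for the least first argument at which
  \<open>f\<close> vanishes and requires \<open>f\<close> to be defined at all smaller ones.\<close>

fun rec_eval :: "recf \<Rightarrow> nat list \<Rightarrow> nat option" where
  "rec_eval Zero xs = Some 0"
| "rec_eval Succ xs = (case xs of [x] \<Rightarrow> Some (Suc x) | _ \<Rightarrow> None)"
| "rec_eval (Proj i) xs = (if i < length xs then Some (xs ! i) else None)"
| "rec_eval (Comp f gs) xs =
     (let ys = map (\<lambda>g. rec_eval g xs) gs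
      in if None \<in> set ys then None else rec_eval f (map the ys))"
| "rec_eval (PrimRec f g) xs =
     (case xs of
        [] \<Rightarrow> None
      | k # ys \<Rightarrow>
          rec_nat (rec_eval f ys)
            (\<lambda>i r. case r of None \<Rightarrow> None | Some v \<Rightarrow> rec_eval g (i # v # ys)) k)"
| "rec_eval (Mu f) xs =
     (if \<exists>y. rec_eval f (y # xs) = Some 0 \<and> (\<forall>z<y. \<exists>v. rec_eval f (z # xs) = Some (Suc v))
      then Some (LEAST y. rec_eval f (y # xs) = Some 0)
      else None)"

text \<open>The partial multiplication table as the list of its rows, an entry being \<open>0\<close> where the
  product is undefined and \<open>Suc k\<close> where it is \<open>k\<close>.\<close>

definition encode_table :: "nat \<Rightarrow> (nat \<Rightarrow> nat \<Rightarrow> nat option) \<Rightarrow> nat" where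
  "encode_table n star =
     list_encode (map (\<lambda>i. list_encode
       (map (\<lambda>j. case star i j of None \<Rightarrow> 0 | Some k \<Rightarrow> Suc k) [0..<n])) [0..<n])"

text \<open>The answer ``not regular'' is \<open>None\<close>; the answer ``regular'' comes with two letters.\<close>

fun encode_answer :: "(nat \<times> nat) option \<Rightarrow> nat" where
  "encode_answer None = 0"
| "encode_answer (Some ef) = Suc (prod_encode ef)"

end

theory Submission imports Defs begin

text \<open>
  Let \<open>S\<close> be a semigroup with biordered set \<open>\<E>\<close>. A letter \<open>h\<close> of a word \<open>uhv\<close> is a seed if
  \<open>uh \<L> h \<R> hv\<close> in \<open>S\<close>. If \<open>k\<close> is an idempotent and \<open>e\<close> a letter, then \<open>ke \<R> k\<close> in \<open>S\<close> iff
  some idempotent \<open>h \<L> k\<close> satisfies \<open>eh = h\<close>, and then \<open>ke \<L> he\<close>, already in \<open>IG(\<E>)\<close>, where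
  \<open>he\<close> is a basic product. Iterating this decides from the table alone whether \<open>h \<R> hv\<close>, shows
  that this relation in \<open>S\<close> is the same as in \<open>IG(\<E>)\<close>, and finds a letter \<open>\<L>\<close>-related to \<open>hv\<close>.
  A word with a seed is therefore regular, and the letters \<open>e\<close>, \<open>f\<close> are computed from the seed.

  Conversely, having a seed, and being a product of at most \<open>k\<close> words that have seeds, are
  invariant under the defining relations. If \<open>z\<close> represents an idempotent, then so does every
  power \<open>z\<^sup>N\<close>, and all of them are products of at most \<open>length z\<close> such words. For large \<open>N\<close> one
  of these words contains a full copy of \<open>z\<close>; finiteness of \<open>E\<close> rules out a bicyclic submonoid
  and lets us move its seed into a power of \<open>z\<close>, so \<open>z\<close> has a seed. A regular word \<open>w \<approx> waw\<close> then
  inherits a seed from the idempotent word \<open>wa\<close>.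
\<close>

section \<open>Seeds\<close>

locale biorder =
  fixes S :: "nat set" and m :: "nat \<Rightarrow> nat \<Rightarrow> nat" and n :: nat
  assumes semigroup: "semigroup_on S m" and idem: "idempotents S m = {..<n}"
begin

abbreviation star :: "nat \<Rightarrow> nat \<Rightarrow> nat option" where
  "star \<equiv> biorder_op S m"

abbreviation cong :: "nat list \<Rightarrow> nat list \<Rightarrow> bool" (infix "\<approx>" 50) where
  "u \<approx> v \<equiv> ig_cong n star u v"

abbreviation words :: "nat list set" where
  "words \<equiv> lists {..<n}"

declare ig_cong.trans [trans]

section \<open>Semigroup laws, duality and basic products\<close>

lemma closed [simp, intro]: "x \<in> S \<Longrightarrow> y \<in> S \<Longrightarrow> m x y \<in> S"
  using semigroup by (auto simp: semigroup_on_def)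

lemma assoc: "x \<in> S \<Longrightarrow> y \<in> S \<Longrightarrow> z \<in> S \<Longrightarrow> m (m x y) z = m x (m y z)"
  using semigroup by (auto simp: semigroup_on_def)

lemma letter_iff: "e < n \<longleftrightarrow> e \<in> S \<and> m e e = e"
  using idem by (auto simp: idempotents_def)

lemma letterI: "e \<in> S \<Longrightarrow> m e e = e \<Longrightarrow> e < n"
  by (simp add: letter_iff)

lemma letter_S [simp]: "e < n \<Longrightarrow> e \<in> S"
  and letter_idem [simp]: "e < n \<Longrightarrow> m e e = e"
  by (simp_all add: letter_iff)

lemma rev_words [simp]: "rev w \<in> words \<longleftrightarrow> w \<in> words"
  by (simp add: in_lists_conv_set)

text \<open>The locale is closed under passing to the opposite semigroup, so each fact about right
  multiplication gives its left counterpart by interpreting the locale there and reversing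
  words.\<close>

lemma dual: "biorder S (\<lambda>x y. m y x) n"
proof
  show "semigroup_on S (\<lambda>x y. m y x)" using semigroup by (auto simp: semigroup_on_def)
  show "idempotents S (\<lambda>x y. m y x) = {..<n}" using idem by (simp add: idempotents_def)
qed

lemma biorder_op_dual: "biorder_op S (\<lambda>x y. m y x) = (\<lambda>e f. star f e)"
  by (intro ext) (auto simp: biorder_op_def basic_pair_def idempotents_def)

text \<open>If \<open>e\<close> is \<open>ef\<close> or \<open>fe\<close>, then
  \<open>(ef)e = e\<close>; if \<open>f\<close> is \<open>ef\<close> or \<open>fe\<close>, then
  \<open>f(ef) = f\<close>. So \<open>ef\<close> is \<R>-related to \<open>e\<close> or \<L>-related
  to \<open>f\<close>, the dichotomy behind the invariance proofs below.\<close>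

lemma basic_pair_cases:
  assumes "e < n" "f < n" "basic_pair m e f"
  shows "(\<exists>t\<in>S. m (m e f) t = e) \<or> (\<exists>t\<in>S. m t (m e f) = f)"
proof -
  have "m (m e f) e = m e (m f e)" "m f (m e f) = m (m f e) f" using assms by (simp_all add: assoc)
  then have "m (m e f) e = e \<or> m f (m e f) = f"
    using assms unfolding basic_pair_iff by (metis letter_idem)
  then show ?thesis using assms by (auto intro: letter_S)
qed

lemma basic_pair_prod:
  assumes "e < n" "f < n" "basic_pair m e f"
  shows "m e f < n"
proof -
  have "m (m e f) (m e f) = m e f"
  proof -
    have "m (m e f) (m e f) = m e (m (m f e) f)" "m e (m e f) = m (m e e) f"
      using assms(1,2) by (simp_all only: assoc closed letter_S)
    then show ?thesis using assms unfolding basic_pair_iff by (metis letter_idem)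
  qed
  then show ?thesis using assms by (intro letterI) auto
qed

lemma star_iff: "star e f = Some g \<longleftrightarrow> e < n \<and> f < n \<and> basic_pair m e f \<and> g = m e f"
  by (auto simp: biorder_op_def idem)

lemma cong_base:
  assumes "e < n" "f < n" "basic_pair m e f"
  shows "[e, f] \<approx> [m e f]"
  using assms basic_pair_prod by (intro ig_cong.base) (auto simp: star_iff)

lemma cong_append:
  assumes "u \<approx> v" "a \<in> words" "b \<in> words"
  shows "a @ u @ b \<approx> a @ v @ b"
proof -
  have 1: "u @ b \<approx> v @ b"
    using assms by (cases "b = []") (auto intro: ig_cong.mult ig_cong.refl)
  then show ?thesis
    using assms by (cases "a = []") (auto intro: ig_cong.mult ig_cong.refl)
qed

lemma cong_append1: "u \<approx> v \<Longrightarrow> a \<in> words \<Longrightarrow> a @ u \<approx> a @ v"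
  and cong_append2: "u \<approx> v \<Longrightarrow> b \<in> words \<Longrightarrow> u @ b \<approx> v @ b"
  using cong_append[of u v a "[]"] cong_append[of u v "[]" b] by auto

lemma cong_dual: "u \<approx> v \<longleftrightarrow> ig_cong n (biorder_op S (\<lambda>x y. m y x)) (rev u) (rev v)"
proof -
  have *: "ig_cong n (\<lambda>e f. s f e) (rev u) (rev v)" if "ig_cong n s u v" for s u v
    using that
  proof induction
    case (base e f g)
    then show ?case by (auto intro: ig_cong.base)
  qed (auto intro: ig_cong.intros)
  show ?thesis
    unfolding biorder_op_dual using *[of star u v] *[of "\<lambda>e f. star f e" "rev u" "rev v"] by auto
qed

section \<open>Actions of words on the semigroup, and seeds\<close>

abbreviation mulr :: "nat \<Rightarrow> nat list \<Rightarrow> nat" (infixl "\<rhd>" 70) where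
  "s \<rhd> x \<equiv> foldl m s x"

abbreviation mull :: "nat list \<Rightarrow> nat \<Rightarrow> nat" (infixr "\<lhd>" 70) where
  "x \<lhd> s \<equiv> foldr m x s"

lemma mulr_closed [simp, intro]: "s \<in> S \<Longrightarrow> x \<in> words \<Longrightarrow> s \<rhd> x \<in> S"
  by (induction x arbitrary: s) auto

lemma mull_closed [simp, intro]: "s \<in> S \<Longrightarrow> x \<in> words \<Longrightarrow> x \<lhd> s \<in> S"
  by (induction x) auto

lemma mulr_assoc: "s \<in> S \<Longrightarrow> t \<in> S \<Longrightarrow> x \<in> words \<Longrightarrow> m s t \<rhd> x = m s (t \<rhd> x)"
  by (induction x arbitrary: t) (auto simp: assoc)

lemma mull_assoc: "s \<in> S \<Longrightarrow> t \<in> S \<Longrightarrow> x \<in> words \<Longrightarrow> x \<lhd> m s t = m (x \<lhd> s) t"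
  by (induction x) (auto simp: assoc)

lemma mul_mull_mul:
  "s \<in> S \<Longrightarrow> t \<in> S \<Longrightarrow> r \<in> S \<Longrightarrow> x \<in> words \<Longrightarrow> m r (x \<lhd> m s t) = m (m r (x \<lhd> s)) t"
  by (simp add: mull_assoc assoc)

lemma mulr_mull: "s \<in> S \<Longrightarrow> t \<in> S \<Longrightarrow> x \<in> words \<Longrightarrow> m (s \<rhd> x) t = m s (x \<lhd> t)"
  by (induction x arbitrary: s) (auto simp: assoc)

text \<open>The defining relations hold in \<open>S\<close>, so the action of words factors through
  the presented semigroup.\<close>

lemma mulr_cong: "u \<approx> v \<Longrightarrow> s \<in> S \<Longrightarrow> s \<rhd> u = s \<rhd> v"
proof (induction arbitrary: s rule: ig_cong.induct)
  case (base e f g)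
  then show ?case by (auto simp: star_iff assoc)
next
  case (mult u u' v v')
  then show ?case using ig_cong_words by (metis foldl_append mulr_closed)
qed auto

text \<open>As \<open>h \<rhd> x\<close> always lies in the right ideal of \<open>h\<close>, for a
  letter \<open>h\<close> this is the relation \<open>h \<R> hx\<close> in \<open>S\<close>;
  \<open>fixl\<close> is its dual.\<close>

definition fixr :: "nat \<Rightarrow> nat list \<Rightarrow> bool" where
  "fixr h x \<longleftrightarrow> (\<exists>t\<in>S. m (h \<rhd> x) t = h)"

definition fixl :: "nat list \<Rightarrow> nat \<Rightarrow> bool" where
  "fixl x h \<longleftrightarrow> (\<exists>t\<in>S. m t (x \<lhd> h) = h)"

text \<open>The letter \<open>h\<close> below is a \<^emph>\<open>seed\<close> of the word: \<open>uh \<L> h \<R> hv\<close>, with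
  the relations taken in \<open>S\<close>.\<close>

definition seeded :: "nat list \<Rightarrow> bool" where
  "seeded w \<longleftrightarrow> w \<in> words \<and> (\<exists>u h v. w = u @ h # v \<and> fixl u h \<and> fixr h v)"

lemma fixl_dual: "fixl x h \<longleftrightarrow> biorder.fixr S (\<lambda>x y. m y x) h (rev x)"
proof -
  interpret D: biorder S "\<lambda>x y. m y x" n by (rule dual)
  show ?thesis by (simp add: fixl_def D.fixr_def foldr_conv_foldl)
qed

lemma fixr_dual: "fixr h x \<longleftrightarrow> biorder.fixl S (\<lambda>x y. m y x) (rev x) h"
proof -
  interpret D: biorder S "\<lambda>x y. m y x" n by (rule dual)
  show ?thesis by (simp add: fixr_def D.fixl_def foldr_conv_foldl)
qed

lemma seeded_dual: "seeded w \<longleftrightarrow> biorder.seeded S (\<lambda>x y. m y x) n (rev w)"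
proof -
  interpret D: biorder S "\<lambda>x y. m y x" n by (rule dual)
  have "(\<exists>u h v. w = u @ h # v \<and> fixl u h \<and> fixr h v) \<longleftrightarrow>
    (\<exists>u h v. rev w = u @ h # v \<and> D.fixl u h \<and> D.fixr h v)" (is "?A \<longleftrightarrow> ?B")
  proof
    assume ?A
    then obtain u h v where "w = u @ h # v" "fixl u h" "fixr h v" by blast
    then show ?B
      by (intro exI[of _ "rev v"] exI[of _ h] exI[of _ "rev u"]) (auto simp: fixl_dual fixr_dual)
  next
    assume ?B
    then obtain u h v where "rev w = u @ h # v" "D.fixl u h" "D.fixr h v" by blast
    then show ?A
      by (intro exI[of _ "rev v"] exI[of _ h] exI[of _ "rev u"])
        (auto simp: fixl_dual fixr_dual rev_swap)
  qed
  then show ?thesis by (simp only: seeded_def D.seeded_def rev_words)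
qed

lemma fixr_Nil [simp]: "h < n \<Longrightarrow> fixr h []"
  by (auto simp: fixr_def intro!: bexI[of _ h])

lemma fixl_Nil [simp]: "h < n \<Longrightarrow> fixl [] h"
  by (auto simp: fixl_def intro!: bexI[of _ h])

text \<open>In the \<R>-order \<open>hx\<close> lies between \<open>hxy\<close> and
  \<open>h\<close>.\<close>

lemma fixr_appendD:
  assumes "fixr h (x @ y)" "h < n" "x \<in> words" "y \<in> words"
  shows "fixr h x"
proof -
  obtain t where t: "t \<in> S" "m (h \<rhd> (x @ y)) t = h" using assms(1) by (auto simp: fixr_def)
  then have "m (h \<rhd> x) (y \<lhd> t) = h" using assms by (simp add: mulr_mull)
  then show ?thesis using t assms by (auto simp: fixr_def)
qed

lemma fixl_appendD:
  assumes "fixl (x @ y) h" "h < n" "x \<in> words" "y \<in> words"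
  shows "fixl y h"
proof -
  interpret D: biorder S "\<lambda>x y. m y x" n by (rule dual)
  show ?thesis using assms D.fixr_appendD[of h "rev y" "rev x"] by (simp add: fixl_dual)
qed

lemma fixr_cong: "u \<approx> v \<Longrightarrow> h < n \<Longrightarrow> x \<in> words \<Longrightarrow> fixr h (x @ u @ y) \<longleftrightarrow> fixr h (x @ v @ y)"
  by (simp add: fixr_def mulr_cong)

lemma seeded_letter: "h < n \<Longrightarrow> seeded [h]"
  by (auto simp: seeded_def intro!: exI[of _ "[]"] exI[of _ h])

lemma seededI: "u @ h # v \<in> words \<Longrightarrow> fixl u h \<Longrightarrow> fixr h v \<Longrightarrow> seeded (u @ h # v)"
  by (auto simp: seeded_def)

lemma seeded_append_cases [consumes 1]:
  assumes "seeded (x @ y)"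
  obtains (left) u h v where "x = u @ h # v" "fixl u h" "fixr h (v @ y)"
    | (right) u h v where "y = u @ h # v" "fixl (x @ u) h" "fixr h v"
proof -
  obtain u h v where *: "x @ y = u @ h # v" "fixl u h" "fixr h v"
    using assms by (auto simp: seeded_def)
  from *(1) show thesis
    unfolding append_eq_append_conv2
  proof (elim exE disjE conjE)
    fix z assume z: "x = u @ z" "z @ y = h # v"
    show thesis
    proof (cases z)
      case Nil
      then show ?thesis using z right[of "[]" h v] * by simp
    next
      case (Cons a z')
      then show ?thesis using z left[of u h z'] * by simp
    qed
  next
    fix z assume z: "x @ z = u" "y = z @ h # v"
    then show thesis using right[of z h v] * by simp
  qed
qed

lemma seeded_words: "seeded w \<Longrightarrow> w \<in> words"
  and seeded_nonempty: "seeded w \<Longrightarrow> w \<noteq> []"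
  by (auto simp: seeded_def)

end

subsection \<open>Runs\<close>

text \<open>For idempotents the first two equations mean \<open>h \<L> k\<close>. All three products
  are basic, so the condition is read off the table.\<close>

definition candidate :: "(nat \<Rightarrow> nat \<Rightarrow> nat option) \<Rightarrow> nat \<Rightarrow> nat \<Rightarrow> nat \<Rightarrow> bool" where
  "candidate star k e h \<longleftrightarrow> star k h = Some k \<and> star h k = Some h \<and> star e h = Some h"

text \<open>If the letter \<open>k\<close> stands for its \<open>\<L>\<close>-class, then \<open>run_step\<close> computes the class of
  \<open>ke\<close> as long as \<open>ke \<R> k\<close>: in that case some letter \<open>h \<L> k\<close> satisfies \<open>eh = h\<close>,
  and \<open>ke \<L> he\<close> where \<open>he\<close> is again a letter.\<close>

definition run_step :: "nat \<Rightarrow> (nat \<Rightarrow> nat \<Rightarrow> nat option) \<Rightarrow> nat \<Rightarrow> nat \<Rightarrow> nat option" where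
  "run_step n star k e =
     (if \<exists>h<n. candidate star k e h then star (LEAST h. candidate star k e h) e else None)"

text \<open>An automaton with letters as states: the state is \<L>-related to the product read so
  far, and the run breaks down once that product leaves the \<R>-class of the starting
  letter.\<close>

definition run :: "nat \<Rightarrow> (nat \<Rightarrow> nat \<Rightarrow> nat option) \<Rightarrow> nat \<Rightarrow> nat list \<Rightarrow> nat option" where
  "run n star h x = foldl (\<lambda>q e. Option.bind q (\<lambda>k. run_step n star k e)) (Some h) x"

lemma run_Nil [simp]: "run n star h [] = Some h"
  and run_snoc [simp]: "run n star h (x @ [e]) = Option.bind (run n star h x) (\<lambda>k. run_step n star k e)"
  by (simp_all add: run_def)

context biorder begin

text \<open>The multiplier \<open>x\<close> may be empty, since principal ideals are taken with an
  identity adjoined.\<close>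

definition leR :: "nat list \<Rightarrow> nat list \<Rightarrow> bool" where
  "leR u v \<longleftrightarrow> (\<exists>x\<in>words. u \<approx> v @ x)"

definition leL :: "nat list \<Rightarrow> nat list \<Rightarrow> bool" where
  "leL u v \<longleftrightarrow> (\<exists>x\<in>words. u \<approx> x @ v)"

lemma candidate_iff:
  "k < n \<Longrightarrow> e < n \<Longrightarrow> candidate star k e h \<longleftrightarrow> h < n \<and> m k h = k \<and> m h k = h \<and> m e h = h"
  by (auto simp: candidate_def star_iff basic_pair_iff)

lemma run_step_SomeD:
  assumes "run_step n star k e = Some q" "k < n" "e < n"
  obtains h where "h < n" "m k h = k" "m h k = h" "m e h = h" "q = m h e" "q < n"
proof -
  define h where "h = (LEAST h. candidate star k e h)"
  have "\<exists>h. candidate star k e h" and st: "star h e = Some q"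
    using assms(1) by (auto simp: run_step_def h_def split: if_splits)
  then have "candidate star k e h" unfolding h_def by (meson LeastI_ex)
  then show thesis using that[of h] st assms basic_pair_prod[of h e]
    by (auto simp: candidate_iff star_iff)
qed

lemma run_step_neq_None:
  assumes "k < n" "e < n" "fixr k [e]"
  shows "run_step n star k e \<noteq> None"
proof -
  obtain t where t: "t \<in> S" "m (m k e) t = k" using assms by (auto simp: fixr_def)
  define h where "h = m e (m t k)"
  have S: "k \<in> S" "e \<in> S" "h \<in> S" using assms t by (auto simp: h_def)
  have "m k h = m (m (m k e) t) k" using t(1) S by (simp add: h_def assoc)
  then have kh: "m k h = k" using t(2) assms(1) by simp
  have hh: "m h k = h" using t(1) S assms(1) by (simp add: h_def assoc)
  have "m e h = m (m e e) (m t k)" using t(1) S by (simp only: h_def assoc closed)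
  then have eh: "m e h = h" using assms(2) by (simp add: h_def)
  have "m (m h k) h = m h (m k h)" using S by (simp add: assoc)
  then have "m h h = h" using kh hh by metis
  then have "h < n" using S by (intro letterI)
  then have c: "candidate star k e h" using kh hh eh assms by (simp add: candidate_iff)
  define l where "l = (LEAST h. candidate star k e h)"
  from c have "candidate star k e l" unfolding l_def by (rule LeastI)
  then have l: "l < n" "m e l = l" using assms by (simp_all add: candidate_iff)
  have "run_step n star k e = star l e" using c \<open>h < n\<close> by (auto simp: run_step_def l_def)
  then show ?thesis using l assms by (simp add: biorder_op_def idem basic_pair_iff)
qed

lemma run_SomeD:
  assumes "run n star h x = Some q" "h < n" "x \<in> words"
  shows "q < n \<and> (\<exists>s\<in>S. q = m s (h \<rhd> x)) \<and> (\<exists>s\<in>S. h \<rhd> x = m s q) \<and> fixr h x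
    \<and> leL (h # x) [q] \<and> leL [q] (h # x) \<and> leR [h] (h # x)"
  using assms
proof (induction x arbitrary: q rule: rev_induct)
  case Nil
  then have h: "q = h" by simp
  have "leL [h] [h]" "leR [h] [h]"
    using Nil by (auto simp: leL_def leR_def intro!: bexI[of _ "[]"] ig_cong.refl)
  then show ?case using Nil h by (auto intro!: bexI[of _ h])
next
  case (snoc e x)
  then have e: "e < n" and x: "x \<in> words" and h: "h < n" by auto
  from snoc.prems obtain k where k: "run n star h x = Some k" "run_step n star k e = Some q"
    by (auto simp: bind_eq_Some_conv)
  define p where "p = h \<rhd> x"
  from snoc.IH[OF k(1) h x] obtain s s' t a b c where IH: "k < n"
    "s \<in> S" "k = m s p" "s' \<in> S" "p = m s' k" "t \<in> S" "m p t = h"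
    "a \<in> words" "h # x \<approx> a @ [k]" "b \<in> words" "[k] \<approx> b @ h # x" "c \<in> words" "[h] \<approx> (h # x) @ c"
    unfolding leL_def leR_def fixr_def p_def by blast
  obtain g where g: "g < n" "m k g = k" "m g k = g" "m e g = g" "q = m g e" "q < n"
    using run_step_SomeD[OF k(2) IH(1) e] .
  have S: "p \<in> S" "k \<in> S" "e \<in> S" "g \<in> S" "q \<in> S" "h \<in> S" using IH g e x h by (auto simp: p_def)
  note W = IH(1,8,10,12)
  have ke: "[k, g] \<approx> [k]" "[g, k] \<approx> [g]" "[e, g] \<approx> [g]" "[g, e] \<approx> [q]"
    using g IH(1) e cong_base[of k g] cong_base[of g k] cong_base[of e g] cong_base[of g e]
    by (auto simp: basic_pair_iff)
  have 1: "[k, e] \<approx> [k, q]"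
  proof -
    have "[k, e] \<approx> [k, g, e]" using cong_append2[OF ke(1)[THEN ig_cong.sym], of "[e]"] e by simp
    also have "\<dots> \<approx> [k, q]" using cong_append1[OF ke(4), of "[k]"] W by simp
    finally show ?thesis .
  qed
  have 2: "[g, k, e] \<approx> [q]"
  proof -
    have "[g, k, e] \<approx> [g, e]" using cong_append2[OF ke(2), of "[e]"] e by simp
    also have "\<dots> \<approx> [q]" by (rule ke)
    finally show ?thesis .
  qed
  have 3: "[k, e, g] \<approx> [k]"
  proof -
    have "[k, e, g] \<approx> [k, g]" using cong_append1[OF ke(3), of "[k]"] W by simp
    also have "\<dots> \<approx> [k]" by (rule ke)
    finally show ?thesis .
  qed
  have L1: "leL (h # x @ [e]) [q]"
  proof -
    have "h # x @ [e] \<approx> a @ [k, e]" using cong_append2[OF IH(9), of "[e]"] e by simp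
    also have "\<dots> \<approx> a @ [k, q]" using cong_append1[OF 1, of a] W by simp
    finally show ?thesis using W
      by (auto simp: leL_def intro!: bexI[of _ "a @ [k]"])
  qed
  have L2: "leL [q] (h # x @ [e])"
  proof -
    have "[q] \<approx> [g, k, e]" by (rule ig_cong.sym[OF 2])
    also have "\<dots> \<approx> (g # b) @ (h # x @ [e])"
      using cong_append[OF IH(11), of "[g]" "[e]"] e g by simp
    finally show ?thesis using W g
      by (auto simp: leL_def intro!: bexI[of _ "g # b"])
  qed
  have R: "leR [h] (h # x @ [e])"
  proof -
    have "[h] \<approx> (h # x) @ c" by (rule IH)
    also have "\<dots> \<approx> (a @ [k]) @ c" by (rule cong_append2[OF IH(9,12)])
    also have "\<dots> \<approx> a @ [k, e, g] @ c"
      using cong_append[OF 3[THEN ig_cong.sym], of a c] W by simp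
    also have "\<dots> \<approx> (h # x) @ e # g # c"
      using cong_append2[OF IH(9)[THEN ig_cong.sym], of "e # g # c"] W e g by simp
    finally show ?thesis using W e g
      by (auto simp: leR_def intro!: bexI[of _ "g # c"])
  qed
  have "m k (m g e) = m (m k g) e" using S by (simp add: assoc)
  then have kq: "m k q = m k e" using g(2,5) by simp
  have "m (m g s) (m p e) = m (m g (m s p)) e" using S IH(2) by (simp add: assoc)
  then have q: "q = m (m g s) (m p e)" using g(3,5) IH(3) by metis
  have "m (m s' k) q = m (m s' k) e" using IH(4) kq S by (simp add: assoc)
  then have pq: "m p e = m p q" by (simp only: IH(5)[symmetric])
  have "m (m s' k) g = m s' (m k g)" using IH(4) S by (simp add: assoc)
  then have "m p g = p" using g(2) IH(5) by metis
  moreover have "m (m p e) (m g t) = m (m p (m e g)) t" using IH(6) S by (simp add: assoc)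
  ultimately have "m (m p e) (m g t) = h" using IH(7) g(4) by metis
  then have f: "fixr h (x @ [e])" using S IH(6) by (auto simp: fixr_def p_def[symmetric])
  have hx: "h \<rhd> (x @ [e]) = m p e" by (simp add: p_def)
  show ?case unfolding hx
  proof (intro conjI)
    show "\<exists>s\<in>S. q = m s (m p e)" using q S IH(2) by blast
    show "\<exists>s\<in>S. m p e = m s q" using pq S by blast
  qed (use L1 L2 R g(6) f in simp_all)
qed

text \<open>Write \<open>p = hx\<close> and let \<open>k = sp\<close> be the state reached. From
  \<open>pet = h\<close> follows \<open>pe(tx) = p\<close>, and multiplying by \<open>s\<close> on
  the left gives \<open>ke(tx) = k\<close>, so the next step is defined.\<close>

lemma fixr_run:
  assumes "fixr h x" "h < n" "x \<in> words"
  shows "run n star h x \<noteq> None"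
  using assms
proof (induction x rule: rev_induct)
  case (snoc e x)
  then have e: "e < n" and x: "x \<in> words" and h: "h < n" by auto
  then have "fixr h x" using snoc.prems fixr_appendD[of h x "[e]"] by simp
  then obtain k where k: "run n star h x = Some k" using snoc.IH h x by auto
  define p where "p = h \<rhd> x"
  obtain s where s: "k < n" "s \<in> S" "k = m s p" using run_SomeD[OF k h x] by (auto simp: p_def)
  obtain t where t: "t \<in> S" "m (m p e) t = h" using snoc.prems by (auto simp: fixr_def p_def)
  have S: "p \<in> S" "e \<in> S" using e x h by (auto simp: p_def)
  have "m (m p e) (t \<rhd> x) = p"
    using mulr_assoc[of "m p e" t x] t S x by (simp add: p_def[symmetric])
  moreover have "m (m k e) (t \<rhd> x) = m s (m (m p e) (t \<rhd> x))" using s S t x by (simp add: assoc)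
  ultimately have "m (m k e) (t \<rhd> x) = k" using s by metis
  then have "fixr k [e]" using t x by (auto simp: fixr_def)
  then show ?case using run_step_neq_None[OF s(1) e] k by simp
qed simp

text \<open>A relation in \<open>S\<close> becomes a test on the table alone.\<close>

lemma run_iff: "h < n \<Longrightarrow> x \<in> words \<Longrightarrow> run n star h x \<noteq> None \<longleftrightarrow> fixr h x"
  using fixr_run run_SomeD by blast

lemma leR_dual: "leR u v \<longleftrightarrow> biorder.leL S (\<lambda>x y. m y x) n (rev u) (rev v)"
proof -
  interpret D: biorder S "\<lambda>x y. m y x" n by (rule dual)
  have "(\<exists>x\<in>words. D.cong (rev u) (rev (v @ x))) \<longleftrightarrow> (\<exists>x\<in>words. D.cong (rev u) (x @ rev v))"
    by (metis in_lists_conv_set rev_append rev_rev_ident set_rev)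
  then show ?thesis by (simp add: leR_def D.leL_def cong_dual[of u])
qed

lemma leL_dual: "leL u v \<longleftrightarrow> biorder.leR S (\<lambda>x y. m y x) n (rev u) (rev v)"
proof -
  interpret D: biorder S "\<lambda>x y. m y x" n by (rule dual)
  show ?thesis using D.leR_dual[of "rev u" "rev v"] by simp
qed

lemma run_left_iff:
  "h < n \<Longrightarrow> x \<in> words \<Longrightarrow> run n (\<lambda>a b. star b a) h (rev x) \<noteq> None \<longleftrightarrow> fixl x h"
proof -
  interpret D: biorder S "\<lambda>x y. m y x" n by (rule dual)
  assume "h < n" "x \<in> words"
  then show ?thesis using D.run_iff[of h "rev x"] by (simp add: fixl_dual biorder_op_dual)
qed

lemma run_left_SomeD:
  assumes "run n (\<lambda>a b. star b a) h (rev x) = Some q" "h < n" "x \<in> words"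
  shows "q < n \<and> leR (x @ [h]) [q] \<and> leR [q] (x @ [h]) \<and> leL [h] (x @ [h])"
proof -
  interpret D: biorder S "\<lambda>x y. m y x" n by (rule dual)
  show ?thesis using D.run_SomeD[of h "rev x" q] assms
    by (simp add: leL_dual leR_dual biorder_op_dual)
qed

text \<open>A seed outside the merged letters survives, because words act through their products. If
  \<open>e\<close> or \<open>f\<close> is the seed, \<open>ef\<close> takes over: one condition
  follows since \<L> is a right and \<R> a left congruence, the other by multiplying the witness by
  \<open>f\<close> or \<open>e\<close>.\<close>

lemma seeded_merge:
  assumes "seeded (a @ [e, f] @ b)" "m e f < n"
  shows "seeded (a @ [m e f] @ b)"
proof -
  let ?g = "m e f"
  have "a @ [e, f] @ b \<in> words" using assms(1) by (rule seeded_words)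
  then have w: "a \<in> words" "b \<in> words" "e < n" "f < n" by auto
  have S: "e \<in> S" "f \<in> S" "?g \<in> S" using w by auto
  have gg: "m e (m f f) = ?g" "m e (m e f) = ?g"
    using w S by (simp_all add: assoc[symmetric])
  from assms(1) show ?thesis
  proof (cases rule: seeded_append_cases)
    case (left u h v)
    then show ?thesis using seededI[of u h "v @ ?g # b"] w assms(2)
      by (auto simp: fixr_def assoc)
  next
    case (right u h v)
    consider "u = []" "h = e" "v = f # b" | "u = [e]" "h = f" "v = b"
      | u' where "u = e # f # u'" "b = u' @ h # v"
      using right(1) by (cases u rule: remdups_adj.cases) auto
    then show ?thesis
    proof cases
      case 1
      obtain s t where st: "s \<in> S" "m s (a \<lhd> e) = e" "t \<in> S" "m (e \<rhd> v) t = e"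
        using right 1 by (auto simp: fixl_def fixr_def)
      have "m s (a \<lhd> ?g) = m (m s (a \<lhd> e)) f" using st w S by (simp add: mul_mull_mul)
      then have "fixl a ?g" using st by (auto simp: fixl_def)
      moreover have "m (?g \<rhd> b) (m t f) = ?g"
        using st 1 w S by (simp add: assoc[symmetric])
      then have "fixr ?g b" using st S by (auto simp: fixr_def)
      ultimately show ?thesis using seededI[of a ?g b] w assms(2) by simp
    next
      case 2
      obtain s t where st: "s \<in> S" "m s (a \<lhd> ?g) = f" "t \<in> S" "m (f \<rhd> b) t = f"
        using right 2 by (auto simp: fixl_def fixr_def)
      have "m (m e s) (a \<lhd> ?g) = ?g" using st w S by (simp add: assoc)
      then have "fixl a ?g" using st S by (auto simp: fixl_def)
      moreover have "m (?g \<rhd> b) t = ?g"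
        using st w S by (simp add: mulr_assoc assoc)
      then have "fixr ?g b" using st S by (auto simp: fixr_def)
      ultimately show ?thesis using seededI[of a ?g b] w assms(2) by simp
    next
      case 3
      have "fixl (a @ ?g # u') h" using right(2) 3 w by (auto simp: fixl_def assoc)
      then show ?thesis using seededI[of "a @ ?g # u'" h v] w assms(2) 3 right by auto
    qed
  qed
qed

text \<open>When \<open>ef\<close> itself is the seed, \<open>e\<close> takes over: multiplying
  \<open>a(ef) \<L> ef\<close> by \<open>t\<close> on the right gives \<open>ae \<L> e\<close>, and
  \<open>e \<R> ef \<R> efb\<close>.\<close>

lemma seeded_split_left:
  assumes "seeded (a @ [m e f] @ b)" "e < n" "f < n" "t \<in> S" "m (m e f) t = e"
  shows "seeded (a @ [e, f] @ b)"
proof -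
  let ?g = "m e f"
  have "a @ [?g] @ b \<in> words" using assms(1) by (rule seeded_words)
  then have w: "a \<in> words" "b \<in> words" "?g < n" by auto
  have S: "e \<in> S" "f \<in> S" "?g \<in> S" using assms by auto
  from assms(1) show ?thesis
  proof (cases rule: seeded_append_cases)
    case (left u h v)
    then show ?thesis using seededI[of u h "v @ [e, f] @ b"] w assms(2,3)
      by (auto simp: fixr_def assoc)
  next
    case (right u h v)
    consider "u = []" "h = ?g" "v = b" | u' where "u = ?g # u'" "b = u' @ h # v"
      using right(1) by (cases u) auto
    then show ?thesis
    proof cases
      case 1
      obtain r s where rs: "s \<in> S" "m s (a \<lhd> ?g) = ?g" "r \<in> S" "m (?g \<rhd> b) r = ?g"
        using right 1 by (auto simp: fixl_def fixr_def)
      have "m s (a \<lhd> m ?g t) = m (m s (a \<lhd> ?g)) t" using rs w S assms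
        by (intro mul_mull_mul) auto
      then have "m s (a \<lhd> e) = e" using rs assms by simp
      then have "fixl a e" using rs by (auto simp: fixl_def)
      moreover have "m (e \<rhd> (f # b)) (m r t) = e"
        using rs w S assms by (simp add: assoc[symmetric])
      then have "fixr e (f # b)" using rs assms by (auto simp: fixr_def)
      ultimately show ?thesis using seededI[of a e "f # b"] w assms by simp
    next
      case 2
      have "fixl (a @ [e, f] @ u') h" using right(2) 2 w assms by (auto simp: fixl_def assoc)
      then show ?thesis using seededI[of "a @ [e, f] @ u'" h v] w assms 2 right by auto
    qed
  qed
qed

lemma seeded_split_right:
  assumes "seeded (a @ [m e f] @ b)" "e < n" "f < n" "t \<in> S" "m t (m e f) = f"
  shows "seeded (a @ [e, f] @ b)"
proof -
  interpret D: biorder S "\<lambda>x y. m y x" n by (rule dual)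
  show ?thesis
    using D.seeded_split_left[where a = "rev b" and e = f and f = e and b = "rev a" and t = t] assms by (simp add: seeded_dual)
qed

lemma seeded_factor_iff:
  assumes "e < n" "f < n" "basic_pair m e f"
  shows "seeded (a @ [e, f] @ b) \<longleftrightarrow> seeded (a @ [m e f] @ b)"
  using seeded_merge[of a e f b] seeded_split_left[of a e f b] seeded_split_right[of a e f b]
    basic_pair_cases[OF assms] basic_pair_prod[OF assms] assms by blast

text \<open>The context words are arbitrary because the product rule of the congruence replaces one
  factor while the other belongs to the context.\<close>

lemma seeded_cong_context: "u \<approx> v \<Longrightarrow> seeded (a @ u @ b) \<longleftrightarrow> seeded (a @ v @ b)"
proof (induction arbitrary: a b rule: ig_cong.induct)
  case (base e f g)
  then have "basic_pair m e f" "g = m e f" by (simp_all add: star_iff)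
  then show ?case using seeded_factor_iff base(1,2) by blast
next
  case (mult u u' v v')
  show ?case using mult.IH(1)[of a "v @ b"] mult.IH(2)[of "a @ u'" b] by simp
qed auto

lemma seeded_cong: "u \<approx> v \<Longrightarrow> seeded u \<longleftrightarrow> seeded v"
  using seeded_cong_context[of u v "[]" "[]"] by simp

end

subsection \<open>Products of words with seeds\<close>

text \<open>Used to locate the two letters of a basic product relative to the factors of a
  word.\<close>

lemma concat_eq_append_split:
  assumes "concat ws = x @ y"
  obtains (cut) us vs where "ws = us @ vs" "x = concat us" "y = concat vs"
    | (inside) us p q vs where "ws = us @ (p @ q) # vs" "p \<noteq> []" "q \<noteq> []"
      "x = concat us @ p" "y = q @ concat vs"
proof -
  have "(\<exists>us vs. ws = us @ vs \<and> x = concat us \<and> y = concat vs) \<or>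
    (\<exists>us p q vs. ws = us @ (p @ q) # vs \<and> p \<noteq> [] \<and> q \<noteq> [] \<and> x = concat us @ p \<and> y = q @ concat vs)"
    (is "?cut ws x \<or> ?inside ws x")
    using assms
  proof (induction ws arbitrary: x)
    case (Cons w ws)
    from Cons.prems consider z where "w = x @ z" "y = z @ concat ws"
      | z where "x = w @ z" "concat ws = z @ y"
      by (auto simp: append_eq_append_conv2)
    then show ?case
    proof cases
      case 1
      consider "x = []" | "z = []" | "x \<noteq> []" "z \<noteq> []" by blast
      then show ?thesis
      proof cases
        case a: 1
        then have "?cut (w # ws) x" using 1 by (intro exI[of _ "[]"] exI[of _ "w # ws"]) simp
        then show ?thesis ..
      next
        case a: 2
        then have "?cut (w # ws) x" using 1 by (intro exI[of _ "[w]"] exI[of _ ws]) simp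
        then show ?thesis ..
      next
        case a: 3
        then have "?inside (w # ws) x" using 1
          by (intro exI[of _ "[]"] exI[of _ x] exI[of _ z] exI[of _ ws]) simp
        then show ?thesis ..
      qed
    next
      case 2
      from Cons.IH[OF 2(2)] show ?thesis
      proof (elim disjE exE conjE)
        fix us vs assume "ws = us @ vs" "z = concat us" "y = concat vs"
        then have "?cut (w # ws) x" using 2(1) by (intro exI[of _ "w # us"] exI[of _ vs]) simp
        then show ?thesis ..
      next
        fix us p q vs
        assume "ws = us @ (p @ q) # vs" "p \<noteq> []" "q \<noteq> []" "z = concat us @ p" "y = q @ concat vs"
        then have "?inside (w # ws) x" using 2(1)
          by (intro exI[of _ "w # us"] exI[of _ p] exI[of _ q] exI[of _ vs]) simp
        then show ?thesis ..
      qed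
    qed
  qed auto
  then show thesis using cut inside by blast
qed

context biorder begin

text \<open>The bound \<open>k\<close> is what is kept under the congruence; it makes the pigeonhole
  argument for powers possible.\<close>

definition factorable :: "nat \<Rightarrow> nat list \<Rightarrow> bool" where
  "factorable k w \<longleftrightarrow> (\<exists>ws. concat ws = w \<and> length ws \<le> k \<and> (\<forall>x\<in>set ws. seeded x))"

lemma seeded_suffix:
  assumes "fixl (x @ u) h" "fixr h v" "x @ u @ h # v \<in> words"
  shows "seeded (u @ h # v)"
  using assms fixl_appendD[of x u h] seededI[of u h v] by auto

lemma seeded_prefix:
  assumes "fixl u h" "fixr h (v @ y)" "u @ h # v @ y \<in> words"
  shows "seeded (u @ h # v)"
  using assms fixr_appendD[of h v y] seededI[of u h v] by auto

text \<open>Two neighbouring factors \<open>xe\<close> and \<open>fy\<close> share the merged letter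
  \<open>g = ef\<close>, where \<open>g \<R> e\<close>. If \<open>fy\<close> has a seed in
  \<open>y\<close>, then \<open>g\<close> joins \<open>x\<close>. Otherwise \<open>f\<close> is the
  seed and \<open>g \<R> gy\<close>: if \<open>xe\<close> has a seed in \<open>x\<close>, then
  \<open>g\<close> joins \<open>y\<close> and is a seed there; if \<open>e\<close> is the seed, all
  merges into one word with seed \<open>g\<close>. The number of factors never grows.\<close>

lemma merge_across_left:
  assumes "seeded (x @ [e])" "seeded (f # y)" "m e f < n" "t \<in> S" "m (m e f) t = e"
  shows "(seeded (x @ [m e f]) \<and> seeded y) \<or> (seeded x \<and> seeded (m e f # y))
    \<or> seeded (x @ m e f # y)"
proof -
  let ?g = "m e f"
  have "x @ [e] \<in> words" "f # y \<in> words" using assms seeded_words by blast+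
  then have w: "x \<in> words" "y \<in> words" "e < n" "f < n" "?g < n" using assms(3) by auto
  have S: "e \<in> S" "f \<in> S" "?g \<in> S" using w by auto
  have left_end: "fixl x ?g" if a: "fixl x e"
  proof -
    obtain s where s: "s \<in> S" "m s (x \<lhd> e) = e" using a by (auto simp: fixl_def)
    have "m s (x \<lhd> ?g) = m (m s (x \<lhd> e)) f" using s w S by (simp add: mul_mull_mul)
    then show ?thesis using s by (auto simp: fixl_def)
  qed
  \<comment> \<open>Since \<open>gt = e\<close>, replacing a final \<open>e\<close> by
    \<open>g\<close> preserves the \<R>-relation.\<close>
  have mid: "fixr h (v @ [?g])" if a: "fixr h (v @ [e])" "h < n" "v \<in> words" for h v
  proof -
    obtain s where s: "s \<in> S" "m (m (h \<rhd> v) e) s = h" using a by (auto simp: fixr_def)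
    have "m (m (h \<rhd> v) ?g) (m t s) = m (m (h \<rhd> v) (m ?g t)) s"
      using s a w S assms(4) by (simp add: assoc)
    then have "m (m (h \<rhd> v) ?g) (m t s) = h" using s assms(5) by metis
    then show ?thesis using s assms by (auto simp: fixr_def)
  qed
  have x_cases: "(\<exists>u h v. x = u @ h # v \<and> fixl u h \<and> fixr h (v @ [e])) \<or> fixl x e"
    using assms(1)
  proof (cases rule: seeded_append_cases)
    case (right u h v)
    then show ?thesis by (auto simp: Cons_eq_append_conv)
  qed auto
  have y_cases: "(\<exists>u h v. y = u @ h # v \<and> fixl (f # u) h \<and> fixr h v) \<or> fixr f y"
  proof -
    have "seeded ([f] @ y)" using assms(2) by simp
    then show ?thesis
    proof (cases rule: seeded_append_cases)
      case (left u h v)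
      then show ?thesis by (auto simp: Cons_eq_append_conv)
    qed auto
  qed
  have xg: "seeded (x @ [?g])"
    using x_cases
  proof (elim disjE exE conjE)
    fix u h v assume *: "x = u @ h # v" "fixl u h" "fixr h (v @ [e])"
    then show ?thesis using mid[of h v] seededI[of u h "v @ [?g]"] w by auto
  next
    assume "fixl x e"
    then show ?thesis using left_end seededI[of x ?g "[]"] w by auto
  qed
  from y_cases show ?thesis
  proof (elim disjE exE conjE)
    fix u h v assume "y = u @ h # v" "fixl (f # u) h" "fixr h v"
    then have "seeded y" using seeded_suffix[of "[f]" u h v] w by auto
    then show ?thesis using xg by blast
  next
    assume "fixr f y"
    then obtain r where r: "r \<in> S" "m (f \<rhd> y) r = f" by (auto simp: fixr_def)
    then have "m (?g \<rhd> y) r = ?g" using w S by (simp add: mulr_assoc assoc)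
    then have g: "fixr ?g y" using r by (auto simp: fixr_def)
    from x_cases show ?thesis
    proof (elim disjE exE conjE)
      fix u h v assume "x = u @ h # v" "fixl u h" "fixr h (v @ [e])"
      then have "seeded x" using seeded_prefix[of u h v "[e]"] w by auto
      moreover have "seeded (?g # y)" using seededI[of "[]" ?g y] g w by auto
      ultimately show ?thesis by blast
    next
      assume "fixl x e"
      then show ?thesis using left_end g seededI[of x ?g y] w by auto
    qed
  qed
qed

lemma merge_across:
  assumes "seeded (x @ [e])" "seeded (f # y)" "e < n" "f < n" "basic_pair m e f"
  shows "(seeded (x @ [m e f]) \<and> seeded y) \<or> (seeded x \<and> seeded (m e f # y))
    \<or> seeded (x @ m e f # y)"
proof -
  interpret D: biorder S "\<lambda>x y. m y x" n by (rule dual)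
  from basic_pair_cases[OF assms(3-5)] show ?thesis
  proof (elim disjE bexE)
    fix t assume "t \<in> S" "m (m e f) t = e"
    then show ?thesis using merge_across_left assms basic_pair_prod by blast
  next
    fix t assume "t \<in> S" "m t (m e f) = f"
    then show ?thesis
      using D.merge_across_left[where x = "rev y" and e = f and f = e and y = "rev x" and t = t] assms basic_pair_prod
      by (auto simp: seeded_dual)
  qed
qed

lemma factorable_append:
  "\<forall>x\<in>set ws. seeded x \<Longrightarrow> \<forall>x\<in>set ws'. seeded x \<Longrightarrow> \<forall>x\<in>set vs. seeded x \<Longrightarrow>
    length ws + length vs + length ws' \<le> k \<Longrightarrow>
    factorable k (concat ws @ concat vs @ concat ws')"
  unfolding factorable_def by (rule exI[of _ "ws @ vs @ ws'"]) auto

text \<open>If a factor boundary separates \<open>e\<close> from \<open>f\<close>, the two adjacent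
  factors are rearranged by \<open>merge_across\<close>; otherwise both letters lie in one factor,
  which keeps a seed.\<close>

lemma factorable_merge:
  assumes "factorable k (a @ [e, f] @ b)" "e < n" "f < n" "basic_pair m e f"
  shows "factorable k (a @ [m e f] @ b)"
proof -
  let ?g = "m e f"
  obtain ws where ws: "concat ws = (a @ [e]) @ f # b" "length ws \<le> k" "\<forall>x\<in>set ws. seeded x"
    using assms(1) by (auto simp: factorable_def)
  from ws(1) show ?thesis
  proof (cases rule: concat_eq_append_split)
    case (cut us vs)
    have "us \<noteq> []" "vs \<noteq> []" using cut(2,3) by auto
    then obtain us' x' y' vs' where uv: "us = us' @ [x']" "vs = y' # vs'"
      by (metis list.exhaust rev_exhaust)
    have ne: "x' \<noteq> []" "y' \<noteq> []" using ws(3) cut uv by (auto dest: seeded_nonempty)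
    obtain x where x: "x' = x @ [e]" "a = concat us' @ x"
      using cut(2) uv ne by (cases x' rule: rev_cases) auto
    obtain y where y: "y' = f # y" "b = y @ concat vs'"
      using cut(3) uv ne by (cases y') auto
    have "seeded (x @ [e])" "seeded (f # y)" using ws(3) cut uv x y by auto
    from merge_across[OF this assms(2-4)]
    obtain zs where zs: "concat zs = x @ ?g # y" "\<forall>z\<in>set zs. seeded z" "length zs \<le> 2"
    proof (elim disjE conjE)
      assume "seeded (x @ [?g])" "seeded y"
      then show thesis using that[of "[x @ [?g], y]"] by simp
    next
      assume "seeded x" "seeded (?g # y)"
      then show thesis using that[of "[x, ?g # y]"] by simp
    next
      assume "seeded (x @ ?g # y)"
      then show thesis using that[of "[x @ ?g # y]"] by simp
    qed
    have eq: "a @ [?g] @ b = concat us' @ concat zs @ concat vs'"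
      by (simp add: x(2) y(2) zs)
    show ?thesis
      unfolding eq by (rule factorable_append) (use ws(2,3) zs in \<open>simp_all add: cut(1) uv\<close>)
  next
    case (inside us p q vs)
    obtain p' q' where pq: "p = p' @ [e]" "q = f # q'" "a = concat us @ p'" "b = q' @ concat vs"
      using inside by (cases p rule: rev_cases; cases q) auto
    have "seeded (p' @ [e, f] @ q')" using ws(3) by (simp add: inside(1) pq(1,2))
    then have "seeded (p' @ [?g] @ q')" using seeded_factor_iff[OF assms(2-4)] by simp
    moreover have eq: "a @ [?g] @ b = concat us @ concat [p' @ [?g] @ q'] @ concat vs"
      by (simp add: pq(3,4))
    ultimately show ?thesis
      unfolding eq by (intro factorable_append) (use ws(2,3) in \<open>simp_all add: inside(1)\<close>)
  qed
qed

text \<open>The letter \<open>ef\<close> lies in a single factor, and splitting it there preserves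
  having a seed.\<close>

lemma factorable_split:
  assumes "factorable k (a @ [m e f] @ b)" "e < n" "f < n" "basic_pair m e f"
  shows "factorable k (a @ [e, f] @ b)"
proof -
  obtain ws where ws: "concat ws = a @ m e f # b" "length ws \<le> k" "\<forall>x\<in>set ws. seeded x"
    using assms(1) by (auto simp: factorable_def)
  obtain us p q vs where s: "ws = us @ (p @ m e f # q) # vs" "a = concat us @ p" "b = q @ concat vs"
    using ws(1)
  proof (cases rule: concat_eq_append_split)
    case (cut us vs)
    have "vs \<noteq> []" using cut by auto
    then obtain y' vs' where uv: "vs = y' # vs'" by (cases vs) auto
    have "y' \<noteq> []" using ws(3) cut uv by (auto dest: seeded_nonempty)
    then obtain y where y: "y' = m e f # y" "b = y @ concat vs'"
      using cut(3) uv by (cases y') auto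
    then show ?thesis using that[of us "[]" y vs'] cut uv by simp
  next
    case (inside us p q vs)
    then show ?thesis using that[of us p "tl q" vs] by (cases q) auto
  qed
  have "seeded (p @ [m e f] @ q)" using ws(3) by (simp add: s(1))
  then have "seeded (p @ [e, f] @ q)" using seeded_factor_iff[OF assms(2-4)] by simp
  moreover have eq: "a @ [e, f] @ b = concat us @ concat [p @ [e, f] @ q] @ concat vs"
    by (simp add: s(2,3))
  ultimately show ?thesis
    unfolding eq by (intro factorable_append) (use ws(2,3) in \<open>simp_all add: s(1)\<close>)
qed

lemma factorable_cong_context: "u \<approx> v \<Longrightarrow> factorable k (a @ u @ b) \<longleftrightarrow> factorable k (a @ v @ b)"
proof (induction arbitrary: a b rule: ig_cong.induct)
  case (base e f g)
  then have "basic_pair m e f" "g = m e f" by (simp_all add: star_iff)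
  then show ?case using factorable_merge factorable_split base(1,2) by blast
next
  case (mult u u' v v')
  show ?case using mult.IH(1)[of a "v @ b"] mult.IH(2)[of "a @ u'" b] by simp
next
  case (sym u v)
  show ?case using sym.IH[of a b] by simp
next
  case (trans u v w)
  show ?case using trans.IH(1)[of a b] trans.IH(2)[of a b] by simp
qed simp

lemma factorable_cong: "u \<approx> v \<Longrightarrow> factorable k u \<longleftrightarrow> factorable k v"
  using factorable_cong_context[of u v k "[]" "[]"] by simp

lemma factorable_length: "w \<in> words \<Longrightarrow> factorable (length w) w"
  unfolding factorable_def
proof (intro exI conjI ballI)
  show "concat (map (\<lambda>x. [x]) w) = w" by simp
  assume "w \<in> words"
  fix y assume "y \<in> set (map (\<lambda>x. [x]) w)"
  with \<open>w \<in> words\<close> show "seeded y" by (auto simp: in_lists_conv_set intro: seeded_letter)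
qed simp

subsection \<open>Idempotent words\<close>

text \<open>Otherwise \<open>q\<close> and its right inverse would generate a bicyclic monoid, which has infinitely
  many idempotents.\<close>

lemma left_inverse:
  assumes "h < n" "q \<in> S" "m h q = q" "m q h = q" "t \<in> S" "m q t = h"
  shows "\<exists>s\<in>S. m s q = h"
proof -
  \<comment> \<open>Cutting \<open>t\<close> down to the local monoid \<open>hSh\<close>, where
    \<open>q\<close> lies and \<open>h\<close> is the identity.\<close>
  define r where "r = m h (m t h)"
  have S: "h \<in> S" "r \<in> S" using assms by (auto simp: r_def)
  have "m h r = m (m h h) (m t h)" "m r h = m h (m t (m h h))"
    using S(1) assms(5) by (simp_all only: r_def assoc closed)
  then have r: "m h r = r" "m r h = r" using assms(1) by (simp_all add: r_def)
  have qr: "m q r = h"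
  proof -
    have "m q r = m (m (m q h) t) h" using assms(2,5) S by (simp add: r_def assoc)
    then show ?thesis using assms by simp
  qed
  \<comment> \<open>Powers of \<open>x\<close> in that monoid, the zeroth being
    \<open>h\<close>.\<close>
  define P where "P = (\<lambda>x i. ((\<lambda>y. m y x) ^^ i) h)"
  have P_Suc: "P x (Suc i) = m (P x i) x" and P_0: "P x 0 = h" for x i by (simp_all add: P_def)
  have P_S: "P x i \<in> S" if "x \<in> S" for x i
    using that S by (induction i) (auto simp: P_Suc P_0)
  have P_h: "m (P x i) h = P x i" "m h (P x i) = P x i" if "x \<in> S" "m h x = x" "m x h = x" for x i
    using that S assms(1) P_S[of x] by (induction i) (auto simp: P_Suc P_0 assoc, simp add: assoc[symmetric])
  have P_add: "P x (i + j) = m (P x i) (P x j)" if "x \<in> S" "m h x = x" "m x h = x" for x i j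
    using that S P_S[of x] P_h[OF that] by (induction j) (auto simp: P_Suc P_0 assoc)
  have P_Suc': "P x (Suc i) = m x (P x i)" if "x \<in> S" "m h x = x" "m x h = x" for x i
    using P_add[OF that, of 1 i] that by (simp add: P_Suc P_0)
  note q = assms(2,3,4)
  note r' = S(2) r
  have QP: "m (P q i) (P r i) = h" for i
  proof (induction i)
    case (Suc i)
    have "m (P q (Suc i)) (P r (Suc i)) = m q (m (m (P q i) (P r i)) r)"
      using P_S q r' by (simp add: P_Suc'[OF q] P_Suc[of r] assoc)
    then show ?case using Suc qr r by simp
  qed (use assms(1) in \<open>simp add: P_0\<close>)
  \<comment> \<open>Because \<open>q\<close> and \<open>r\<close> multiply to \<open>h\<close>,
    every \<open>r^i q^i\<close> is idempotent, so two of these finitely many elements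
    coincide.\<close>
  have "m (P r i) (P q i) < n" for i
  proof (rule letterI)
    have "m (m (P r i) (P q i)) (m (P r i) (P q i)) = m (P r i) (m (m (P q i) (P r i)) (P q i))"
      using P_S q r' by (simp add: assoc)
    then show "m (m (P r i) (P q i)) (m (P r i) (P q i)) = m (P r i) (P q i)"
      using QP P_h[OF q] by simp
  qed (use P_S q r' in auto)
  then have "range (\<lambda>i. m (P r i) (P q i)) \<subseteq> {..<n}" by auto
  then have "finite (range (\<lambda>i. m (P r i) (P q i)))" using finite_subset by blast
  then have "\<not> inj (\<lambda>i. m (P r i) (P q i))" using infinite_UNIV_nat finite_imageD by blast
  then obtain i j where ij: "i < j" "m (P r i) (P q i) = m (P r j) (P q j)"
    unfolding inj_def by (metis nat_neq_iff)
  define d where "d = j - i - 1"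
  have j: "j = i + Suc d" "j = Suc d + i" using ij by (auto simp: d_def)
  \<comment> \<open>Sandwiching \<open>r^i q^i = r^j q^j\<close> between \<open>q^i\<close> and
    \<open>r^i\<close> leaves \<open>h = r^(d+1) q^(d+1)\<close>, so \<open>r^(d+1) q^d\<close> is a
    left inverse of \<open>q\<close>.\<close>
  have "h = m (m (P q i) (m (P r i) (P q i))) (P r i)"
  proof -
    have "m (m (P q i) (m (P r i) (P q i))) (P r i) = m (m (P q i) (P r i)) (m (P q i) (P r i))"
      using P_S q r' by (simp add: assoc)
    then show ?thesis using QP assms(1) by simp
  qed
  also have "\<dots> = m (m (P q i) (m (P r j) (P q j))) (P r i)" using ij by simp
  also have "P r j = m (P r i) (P r (Suc d))" unfolding j(1) by (rule P_add[OF r'])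
  also have "P q j = m (P q (Suc d)) (P q i)" unfolding j(2) by (rule P_add[OF q])
  also have "m (m (P q i) (m (m (P r i) (P r (Suc d))) (m (P q (Suc d)) (P q i)))) (P r i) =
    m (m (P q i) (P r i)) (m (m (P r (Suc d)) (P q (Suc d))) (m (P q i) (P r i)))"
    using P_S q r' by (simp add: assoc)
  also have "\<dots> = m (m h (P r (Suc d))) (m (P q (Suc d)) h)"
    using P_S q r' S by (simp add: QP assoc)
  also have "\<dots> = m (P r (Suc d)) (P q (Suc d))" using P_h[OF q] P_h[OF r'] by simp
  also have "\<dots> = m (m (P r (Suc d)) (P q d)) q" using P_S q r' by (simp add: P_Suc assoc)
  finally show ?thesis using P_S q r' by (metis closed)
qed

text \<open>The element \<open>hxh\<close> of the local monoid at \<open>h\<close> is right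
  invertible by assumption, hence left invertible by \<open>left_inverse\<close>.\<close>

lemma fixr_imp_fixl:
  assumes "fixr h (x @ [h])" "h < n" "x \<in> words"
  shows "fixl (h # x) h"
proof -
  define q where "q = h \<rhd> (x @ [h])"
  have S: "h \<in> S" "q \<in> S" using assms by (auto simp: q_def)
  have q: "q = m h (x \<lhd> h)" using mulr_mull[of h h x] assms by (simp add: q_def)
  have "m h (m h (x \<lhd> h)) = m (m h h) (x \<lhd> h)" using assms by (simp only: assoc mull_closed letter_S)
  then have 1: "m h q = q" using assms by (simp add: q)
  have 2: "m q h = q" using assms by (simp add: q_def assoc)
  obtain t where "t \<in> S" "m q t = h" using assms by (auto simp: fixr_def q_def)
  then obtain s where "s \<in> S" "m s q = h" using left_inverse[OF assms(2) S(2) 1 2] by blast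
  then show ?thesis by (auto simp: fixl_def q)
qed

end

text \<open>Read the factors from the left, \<open>x\<close> being what precedes the next copy of
  \<open>z\<close>. A factor not containing that copy ends before the copy does, so it exhausts no
  more than the current copy and leaves a nonempty rest. With at most \<open>N\<close> factors for
  \<open>N\<close> copies this cannot go on to the end. The words \<open>r\<close> and
  \<open>s'\<close> record how the surroundings of the copy complete to powers of
  \<open>z\<close>.\<close>

lemma pigeonhole_power:
  assumes "concat ws = x @ concat (replicate N z)" "r @ x = concat (replicate i z)"
    "length ws \<le> N" "0 < N" "z \<noteq> []"
  obtains p x' y' r' s' i' j' where "p \<in> set ws" "p = x' @ z @ y'"
    "r' @ x' = concat (replicate i' z)" "y' @ s' = concat (replicate j' z)"
proof -
  have comm: "concat (replicate k z) @ z = z @ concat (replicate k z)" for k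
    by (induction k) auto
  have "\<exists>p\<in>set ws. \<exists>x' y' r' s' i' j'. p = x' @ z @ y' \<and>
    r' @ x' = concat (replicate i' z) \<and> y' @ s' = concat (replicate j' z)"
    using assms
  proof (induction ws arbitrary: x N r i)
    case (Cons p ws)
    then obtain M where N: "N = Suc M" by (cases N) auto
    have eq: "p @ concat ws = (x @ z) @ concat (replicate M z)"
      using Cons.prems(1) by (simp add: N)
    show ?case
    proof (cases "\<exists>y. p = x @ z @ y \<and> y @ concat ws = concat (replicate M z)")
      case True
      then obtain y where "p = x @ z @ y" "y @ concat ws = concat (replicate M z)" by blast
      then show ?thesis using Cons.prems(2) by (intro bexI[of _ p]) auto
    next
      case False
      then obtain x1 where x1: "p @ x1 = x @ z" "concat ws = x1 @ concat (replicate M z)" "x1 \<noteq> []"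
      proof -
        from eq consider us where "p = (x @ z) @ us" "us @ concat ws = concat (replicate M z)"
          | us where "p @ us = x @ z" "concat ws = us @ concat (replicate M z)"
          unfolding append_eq_append_conv2[of p] by blast
        then show ?thesis
        proof cases
          case 1
          then show ?thesis using False by simp
        next
          case 2
          moreover from 2 False have "us \<noteq> []" by auto
          ultimately show ?thesis using that by blast
        qed
      qed
      have 1: "(r @ p) @ x1 = concat (replicate (Suc i) z)"
        using x1(1) Cons.prems(2) comm[of i] by (metis append_assoc concat.simps(2) replicate_Suc)
      have 2: "length ws \<le> M" using Cons.prems(3) N by simp
      have 3: "0 < M" using x1(2,3) 2 by (cases M) auto
      from Cons.IH[OF x1(2) 1 2 3 Cons.prems(5)] show ?thesis
        by (rule bexE) (rule bexI, assumption, simp)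
    qed
  qed auto
  then show thesis using that by blast
qed

context biorder begin

lemma power_cong:
  assumes "z @ z \<approx> z" "0 < i"
  shows "concat (replicate i z) \<approx> z"
  using assms(2)
proof (induction i rule: nat_induct_non_zero)
  case 1
  then show ?case using ig_cong_words[OF assms(1)] by (auto intro: ig_cong.refl)
next
  case (Suc i)
  have "concat (replicate (Suc i) z) \<approx> z @ z"
    using cong_append1[OF Suc(2), of z] ig_cong_words[OF assms(1)] by simp
  also have "\<dots> \<approx> z" by fact
  finally show ?case .
qed

text \<open>The seed \<open>h\<close> of the word \<open>x' h x'' z y\<close> turns out to be a seed of the power
  \<open>r x' h x''\<close> of \<open>z\<close>.\<close>

lemma seeded_idempotent_left:
  assumes z: "z @ z \<approx> z" and x: "r @ x' @ h # x'' = concat (replicate i z)"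
    and l: "fixl x' h" and fr: "fixr h (x'' @ z @ y)" and y: "y \<in> words"
  shows "seeded z"
proof -
  have zw: "z \<in> words" "z \<noteq> []" using ig_cong_words[OF z] by auto
  have "set (concat (replicate i z)) \<subseteq> {..<n}" using zw by (auto simp: in_lists_conv_set)
  then have w: "r \<in> words" "x' \<in> words" "h < n" "x'' \<in> words"
    unfolding x[symmetric] by (auto simp: in_lists_conv_set)
  have i: "0 < i" using x by (cases i) auto
  \<comment> \<open>Replacing \<open>z\<close> by \<open>z\<close> followed by its power
    \<open>r x' h x''\<close> makes \<open>h\<close> occur again after itself. The \<R>-relation up
    to that second occurrence is turned by \<open>fixr_imp_fixl\<close> into an \<L>-relation, from
    which only the suffix \<open>r x'\<close> before \<open>h\<close> is kept.\<close>
  have "z \<approx> z @ concat (replicate i z)"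
    using power_cong[OF z, of "Suc i"] by (auto intro: ig_cong.sym)
  moreover have "fixr h (x'' @ z)" using fixr_appendD[of h "x'' @ z" y] fr w y zw by simp
  ultimately have "fixr h (x'' @ z @ concat (replicate i z))"
    using fixr_cong[of z "z @ concat (replicate i z)" h x'' "[]"] w by simp
  then have "fixr h ((x'' @ z @ r @ x' @ [h]) @ x'')" unfolding x[symmetric] by simp
  then have "fixr h ((x'' @ z @ r @ x') @ [h])"
    using fixr_appendD[of h "x'' @ z @ r @ x' @ [h]" x''] w zw by simp
  then have "fixl (h # x'' @ z @ r @ x') h" using fixr_imp_fixl w zw by auto
  then have "fixl (r @ x') h" using fixl_appendD[of "h # x'' @ z" "r @ x'" h] w zw by simp
  moreover have "fixr h x''" using fixr_appendD[of h x'' "z @ y"] fr w y zw by simp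
  ultimately have "seeded (concat (replicate i z))"
    unfolding x[symmetric] using seededI[of "r @ x'" h x''] w by simp
  then show ?thesis using seeded_cong[OF power_cong[OF z i]] by simp
qed

text \<open>Some factor \<open>xzy\<close> of a power of \<open>z\<close> has a seed. If it lies in
  \<open>z\<close>, it is a seed of \<open>z\<close>; if in \<open>x\<close>,
  \<open>seeded_idempotent_left\<close> applies, and if in \<open>y\<close>, its dual.\<close>

lemma seeded_idempotent:
  assumes z: "z @ z \<approx> z"
  shows "seeded z"
proof -
  interpret D: biorder S "\<lambda>x y. m y x" n by (rule dual)
  have zw: "z \<in> words" "z \<noteq> []" using ig_cong_words[OF z] by auto
  \<comment> \<open>As many copies of \<open>z\<close> as it has letters: splitting into letters
    bounds the factors of \<open>z\<close>, and hence of \<open>z^N\<close>, by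
    \<open>N\<close>.\<close>
  define N where "N = length z"
  have N: "0 < N" using zw by (simp add: N_def)
  have "factorable N (concat (replicate N z))"
    using factorable_length[OF zw(1)] factorable_cong[OF power_cong[OF z N]] by (simp add: N_def)
  then obtain ws where ws: "concat ws = [] @ concat (replicate N z)" "length ws \<le> N"
    "\<forall>x\<in>set ws. seeded x" by (auto simp: factorable_def)
  have "[] @ [] = concat (replicate 0 z)" by simp
  from pigeonhole_power[OF ws(1) this ws(2) N zw(2)] obtain p x y r s i j
    where p: "p \<in> set ws" "p = x @ z @ y" "r @ x = concat (replicate i z)"
      "y @ s = concat (replicate j z)" .
  have "seeded (x @ z @ y)" using ws(3) p(1,2) by simp
  from seeded_words[OF this] have w: "x \<in> words" "y \<in> words" by auto
  from \<open>seeded (x @ z @ y)\<close> show ?thesis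
  proof (cases rule: seeded_append_cases)
    case (left u h v)
    then show ?thesis using seeded_idempotent_left[OF z _ left(2,3), of r i] p(3) w by simp
  next
    case (right u h v)
    have "x @ u @ h # v \<in> words" unfolding right(1)[symmetric] using w zw by simp
    then have "seeded (z @ y)" unfolding right(1) using seeded_suffix[OF right(2,3)] by simp
    from this show ?thesis
    proof (cases rule: seeded_append_cases)
      case (left u h v)
      then show ?thesis using seeded_prefix[of u h v y] zw w by auto
    next
      case (right u h v)
      have "rev s @ rev v @ h # rev u = rev (concat (replicate j z))"
        unfolding p(4)[symmetric] right(1) by simp
      also have "\<dots> = concat (replicate j (rev z))" by (simp add: rev_concat)
      finally have "rev s @ rev v @ h # rev u = concat (replicate j (rev z))" .
      moreover have "D.cong (rev z @ rev z) (rev z)" using z cong_dual[of "z @ z" z] by simp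
      moreover have "D.fixl (rev v) h" using right(3) by (simp add: fixr_dual)
      moreover have "D.fixr h (rev u @ rev z @ [])" using right(2) by (simp add: fixl_dual)
      ultimately have "D.seeded (rev z)" using D.seeded_idempotent_left by blast
      then show ?thesis by (simp add: seeded_dual)
    qed
  qed
qed

text \<open>From \<open>w = ky\<close> and \<open>kk = k\<close> comes \<open>kw = w\<close>; from
  \<open>k = wx\<close> comes \<open>k = kk = wxk\<close>, which is then let act on \<open>k\<close>
  in \<open>S\<close>.\<close>

lemma fixr_if_leR:
  assumes "leR [k] w" "leR w [k]" "k < n"
  shows "fixr k w" "[k] @ w \<approx> w"
proof -
  obtain x y where x: "x \<in> words" "[k] \<approx> w @ x" and y: "y \<in> words" "w \<approx> [k] @ y"
    using assms by (auto simp: leR_def)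
  have kk: "[k, k] \<approx> [k]" using cong_base[of k k] assms(3) by (simp add: basic_pair_iff)
  have "[k] @ w \<approx> [k] @ ([k] @ y)" using y(2) assms(3) by (intro cong_append1) auto
  also have "\<dots> \<approx> [k] @ y" using cong_append2[OF kk y(1)] by simp
  also have "\<dots> \<approx> w" by (rule ig_cong.sym[OF y(2)])
  finally show "[k] @ w \<approx> w" .
  have "[k] \<approx> (w @ x) @ [k]"
  proof -
    have "[k] \<approx> [k] @ [k]" using kk by (simp add: ig_cong.sym)
    also have "\<dots> \<approx> (w @ x) @ [k]" using x(2) assms(3) by (intro cong_append2) auto
    finally show ?thesis .
  qed
  then have "k \<rhd> [k] = k \<rhd> ((w @ x) @ [k])" by (rule mulr_cong) (use assms(3) in simp)
  moreover have "w \<in> words" using ig_cong_words[OF y(2)] by simp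
  ultimately have "m (k \<rhd> w) (x \<lhd> k) = k" using x(1) assms(3) by (simp add: mulr_mull[symmetric])
  moreover have "x \<lhd> k \<in> S" using x(1) assms(3) by simp
  ultimately show "fixr k w" unfolding fixr_def by blast
qed

text \<open>The word \<open>wa\<close> is idempotent, so it has a seed. One in \<open>w\<close> is a
  seed of \<open>w\<close>. If the seed \<open>h\<close> lies in \<open>a = uhv\<close>, a run to
  the left yields a letter \<open>k \<R> wuh\<close>; since \<open>w \<approx> wuhvw\<close>, also
  \<open>k \<R> w\<close>. Then \<open>kw \<approx> w\<close>, and \<open>k\<close> is a seed of
  \<open>kw\<close>.\<close>

lemma seeded_regular:
  assumes reg: "w @ a @ w \<approx> w" and aw: "a \<in> words" "a \<noteq> []"
  shows "seeded w"
proof -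
  have w: "w \<in> words" using ig_cong_words[OF reg] by auto
  have "(w @ a) @ (w @ a) \<approx> w @ a" using cong_append2[OF reg aw(1)] by simp
  then have "seeded (w @ a)" by (rule seeded_idempotent)
  then show ?thesis
  proof (cases rule: seeded_append_cases)
    case (left u h v)
    then show ?thesis using seeded_prefix[of u h v a] w aw by auto
  next
    case (right u h v)
    have uhv: "u \<in> words" "h < n" "v \<in> words" using aw right by auto
    obtain k where k: "run n (\<lambda>a b. star b a) h (rev (w @ u)) = Some k"
      using run_left_iff[of h "w @ u"] right uhv w by auto
    from run_left_SomeD[OF this] uhv w
    have kk: "k < n" "leR ((w @ u) @ [h]) [k]" "leR [k] ((w @ u) @ [h])" by auto
    obtain b where b: "b \<in> words" "((w @ u) @ [h]) \<approx> [k] @ b" using kk(2) by (auto simp: leR_def)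
    obtain c where c: "c \<in> words" "[k] \<approx> ((w @ u) @ [h]) @ c" using kk(3) by (auto simp: leR_def)
    have "w \<approx> w @ a @ w" by (rule ig_cong.sym[OF reg])
    also have "w @ a @ w = ((w @ u) @ [h]) @ v @ w" by (simp add: right(1))
    also have "\<dots> \<approx> ([k] @ b) @ v @ w" using uhv w by (intro cong_append2[OF b(2)]) auto
    finally have 1: "leR w [k]" using b uhv w by (auto simp: leR_def intro!: bexI[of _ "b @ v @ w"])
    have 2: "leR [k] w" using c uhv by (auto simp: leR_def intro!: bexI[of _ "u @ h # c"])
    have "seeded ([] @ k # w)" by (rule seededI) (use fixr_if_leR[OF 2 1] kk w in auto)
    then show ?thesis using seeded_cong[OF fixr_if_leR(2)[OF 2 1 kk(1)]] by simp
  qed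
qed

text \<open>Left multiplication by \<open>u\<close> turns \<open>h \<R> hv\<close> into \<open>uh \<R> uhv\<close>.\<close>

lemma seed_R:
  assumes "run n (\<lambda>a b. star b a) h (rev u) = Some k" "fixr h v" "u @ h # v \<in> words"
  shows "k < n" "leR [k] (u @ h # v)" "leR (u @ h # v) [k]"
proof -
  have w: "u \<in> words" "h < n" "v \<in> words" using assms(3) by auto
  from run_left_SomeD[OF assms(1) w(2,1)]
  obtain b c where k: "k < n" and b: "b \<in> words" "u @ [h] \<approx> [k] @ b"
    and c: "c \<in> words" "[k] \<approx> (u @ [h]) @ c" by (auto simp: leR_def)
  obtain q where "run n star h v = Some q" using run_iff[OF w(2,3)] assms(2) by auto
  from run_SomeD[OF this w(2,3)] obtain d where d: "d \<in> words" "[h] \<approx> (h # v) @ d"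
    by (auto simp: leR_def)
  show "k < n" by fact
  have "u @ h # v = (u @ [h]) @ v" by simp
  also have "\<dots> \<approx> ([k] @ b) @ v" by (rule cong_append2[OF b(2) w(3)])
  finally show "leR (u @ h # v) [k]" using b w by (auto simp: leR_def intro!: bexI[of _ "b @ v"])
  have "[k] \<approx> u @ [h] @ c" using c(2) by simp
  also have "\<dots> \<approx> u @ ((h # v) @ d) @ c" by (rule cong_append[OF d(2) w(1) c(1)])
  finally show "leR [k] (u @ h # v)" using c d by (auto simp: leR_def intro!: bexI[of _ "d @ c"])
qed

lemma seed_L:
  assumes "run n star h v = Some q" "fixl u h" "u @ h # v \<in> words"
  shows "q < n" "leL [q] (u @ h # v)" "leL (u @ h # v) [q]"
proof -
  interpret D: biorder S "\<lambda>x y. m y x" n by (rule dual)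
  note * = D.seed_R[of h "rev v" q "rev u"]
  show "q < n" "leL [q] (u @ h # v)" "leL (u @ h # v) [q]"
    using * assms by (simp_all add: leL_dual fixl_dual biorder_op_dual)
qed

section \<open>From words to elements: regularity and Green's relations in the presented
  semigroup\<close>

abbreviation elt :: "nat list \<Rightarrow> nat list set" where
  "elt \<equiv> ig_class n star"

abbreviation IG :: "nat list set set" where
  "IG \<equiv> ig_carrier n star"

abbreviation mulIG :: "nat list set \<Rightarrow> nat list set \<Rightarrow> nat list set" (infixl "\<bullet>" 70) where
  "mulIG \<equiv> ig_mult n star"

lemma elt_IG: "u \<in> words \<Longrightarrow> u \<noteq> [] \<Longrightarrow> elt u \<in> IG"
  by (auto simp: ig_carrier_def)

lemma elt_eq: "u \<approx> v \<Longrightarrow> elt u = elt v"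
  using ig_class_eq_iff ig_cong_words by blast

lemma elt_in_IG_iff:
  assumes "w \<in> words"
  shows "elt w \<in> IG \<longleftrightarrow> w \<noteq> []"
  using assms ig_class_Nil elt_IG by metis

lemma IG_cases:
  assumes "A \<in> IG"
  obtains u where "u \<in> words" "u \<noteq> []" "A = elt u"
  using assms by (auto simp: ig_carrier_def)

text \<open>For a word \<open>uhv\<close> with seed \<open>h\<close>, the runs provide
  \<open>hvy \<approx> h\<close> and \<open>xuh \<approx> h\<close> in the presented semigroup; then
  \<open>a = yhx\<close> satisfies \<open>waw \<approx> w\<close>, as \<open>waw\<close> collapses
  to \<open>uhhhv\<close>.\<close>

lemma regular_iff_seeded:
  assumes "w \<in> words"
  shows "regular_element IG (ig_mult n star) (elt w) \<longleftrightarrow> seeded w"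
proof
  assume r: "regular_element IG (ig_mult n star) (elt w)"
  then have w: "w \<noteq> []" using elt_in_IG_iff[OF assms] by (simp add: regular_element_def)
  obtain A where "A \<in> IG" "elt w \<bullet> A \<bullet> elt w = elt w" using r by (auto simp: regular_element_def)
  then obtain a where a: "a \<in> words" "a \<noteq> []" "elt w \<bullet> elt a \<bullet> elt w = elt w"
    using IG_cases by metis
  have "elt w \<bullet> elt a \<bullet> elt w = elt ((w @ a) @ w)"
    using assms a w by (simp only: ig_mult_class append_is_Nil_conv append_in_lists_conv simp_thms)
  then have "(w @ a) @ w \<approx> w" using a assms w ig_class_eq_iff[of "(w @ a) @ w" n star w] by auto
  then show "seeded w" using seeded_regular[of w a] a by simp
next
  assume "seeded w"
  then obtain u h v where w: "w = u @ h # v" "fixl u h" "fixr h v" by (auto simp: seeded_def)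
  have uhv: "u \<in> words" "h < n" "v \<in> words" using assms w by auto
  obtain k q where k: "run n (\<lambda>a b. star b a) h (rev u) = Some k" and q: "run n star h v = Some q"
    using run_iff[of h v] run_left_iff[of h u] uhv w by auto
  obtain x where x: "x \<in> words" "[h] \<approx> x @ u @ [h]"
    using run_left_SomeD[OF k uhv(2,1)] by (auto simp: leL_def)
  obtain y where y: "y \<in> words" "[h] \<approx> (h # v) @ y"
    using run_SomeD[OF q uhv(2,3)] by (auto simp: leR_def)
  have hh: "[h, h] \<approx> [h]" using cong_base[of h h] uhv by (simp add: basic_pair_iff)
  have "w @ (y @ h # x) @ w = u @ ((h # v) @ y) @ h # x @ w" by (simp add: w)
  also have "\<dots> \<approx> u @ [h] @ h # x @ w"
    by (rule cong_append[OF ig_cong.sym[OF y(2)]]) (use uhv x assms in auto)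
  also have "u @ [h] @ h # x @ w = (u @ [h, h]) @ (x @ u @ [h]) @ v" by (simp add: w)
  also have "\<dots> \<approx> (u @ [h, h]) @ [h] @ v"
    by (rule cong_append[OF ig_cong.sym[OF x(2)]]) (use uhv in auto)
  also have "(u @ [h, h]) @ [h] @ v = u @ [h, h] @ h # v" by simp
  also have "\<dots> \<approx> u @ [h] @ h # v" by (rule cong_append[OF hh]) (use uhv in auto)
  also have "u @ [h] @ h # v = u @ [h, h] @ v" by simp
  also have "\<dots> \<approx> u @ [h] @ v" by (rule cong_append[OF hh]) (use uhv in auto)
  also have "u @ [h] @ v = w" by (simp add: w)
  finally have "w @ (y @ h # x) @ w \<approx> w" .
  then have "elt (w @ (y @ h # x) @ w) = elt w" by (rule elt_eq)
  moreover have "w \<noteq> []" "y @ h # x \<in> words" using w uhv x y by auto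
  ultimately have "elt w \<bullet> elt (y @ h # x) \<bullet> elt w = elt w"
    using assms by (simp add: ig_mult_class)
  then show "regular_element IG (ig_mult n star) (elt w)"
    using elt_IG[of w] elt_IG[of "y @ h # x"] assms \<open>w \<noteq> []\<close> \<open>y @ h # x \<in> words\<close>
    by (auto simp: regular_element_def)
qed

lemma IG_eq_image: "IG = elt ` (words - {[]})"
  by (auto simp: ig_carrier_def)

text \<open>With the empty word supplying the generator itself, inclusion of ideals reduces to
  \<open>leR\<close>.\<close>

lemma right_ideal:
  assumes "v \<in> words" "v \<noteq> []"
  shows "insert (elt v) ((\<lambda>s. elt v \<bullet> s) ` IG) = (\<lambda>x. elt (v @ x)) ` words"
proof -
  have "(\<lambda>s. elt v \<bullet> s) ` IG = (\<lambda>x. elt (v @ x)) ` (words - {[]})"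
    unfolding IG_eq_image image_image by (intro image_cong refl ig_mult_class) (use assms in auto)
  moreover have "words = insert [] (words - {[]})" by auto
  then have "(\<lambda>x. elt (v @ x)) ` words = (\<lambda>x. elt (v @ x)) ` insert [] (words - {[]})"
    by (rule arg_cong)
  ultimately show ?thesis by (simp only: image_insert append_Nil2)
qed

lemma left_ideal:
  assumes "v \<in> words" "v \<noteq> []"
  shows "insert (elt v) ((\<lambda>s. s \<bullet> elt v) ` IG) = (\<lambda>x. elt (x @ v)) ` words"
proof -
  have "(\<lambda>s. s \<bullet> elt v) ` IG = (\<lambda>x. elt (x @ v)) ` (words - {[]})"
    unfolding IG_eq_image image_image by (intro image_cong refl ig_mult_class) (use assms in auto)
  moreover have "words = insert [] (words - {[]})" by auto
  then have "(\<lambda>x. elt (x @ v)) ` words = (\<lambda>x. elt (x @ v)) ` insert [] (words - {[]})"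
    by (rule arg_cong)
  ultimately show ?thesis by (simp only: image_insert append_Nil)
qed

lemma green_R_if_leR:
  assumes "leR u v" "leR v u"
  shows "green_R IG (ig_mult n star) (elt u) (elt v)"
proof -
  have sub: "(\<lambda>x. elt (u @ x)) ` words \<subseteq> (\<lambda>x. elt (v @ x)) ` words" if le: "leR u v" for u v
  proof -
    obtain x where x: "x \<in> words" "u \<approx> v @ x" using le by (auto simp: leR_def)
    show ?thesis
    proof (rule image_subsetI)
      fix y assume y: "y \<in> words"
      have "elt (u @ y) = elt (v @ (x @ y))" using elt_eq[OF cong_append2[OF x(2) y]] by simp
      then show "elt (u @ y) \<in> (\<lambda>x. elt (v @ x)) ` words" by (rule image_eqI) (use x y in auto)
    qed
  qed
  have "u \<in> words" "u \<noteq> []" "v \<in> words" "v \<noteq> []"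
    using assms[unfolded leR_def] by (auto dest: ig_cong_words)
  then show ?thesis
    using sub[OF assms(1)] sub[OF assms(2)] elt_IG by (simp add: green_R_def right_ideal)
qed

lemma green_L_if_leL:
  assumes "leL u v" "leL v u"
  shows "green_L IG (ig_mult n star) (elt u) (elt v)"
proof -
  have sub: "(\<lambda>x. elt (x @ u)) ` words \<subseteq> (\<lambda>x. elt (x @ v)) ` words" if le: "leL u v" for u v
  proof -
    obtain x where x: "x \<in> words" "u \<approx> x @ v" using le by (auto simp: leL_def)
    show ?thesis
    proof (rule image_subsetI)
      fix y assume y: "y \<in> words"
      have "elt (y @ u) = elt ((y @ x) @ v)" using elt_eq[OF cong_append1[OF x(2) y]] by simp
      then show "elt (y @ u) \<in> (\<lambda>x. elt (x @ v)) ` words" by (rule image_eqI) (use x y in auto)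
    qed
  qed
  have "u \<in> words" "u \<noteq> []" "v \<in> words" "v \<noteq> []"
    using assms[unfolded leL_def] by (auto dest: ig_cong_words)
  then show ?thesis
    using sub[OF assms(1)] sub[OF assms(2)] elt_IG by (simp add: green_L_def left_ideal)
qed

end

section \<open>The decision procedure on words\<close>

definition seed_at :: "nat \<Rightarrow> (nat \<Rightarrow> nat \<Rightarrow> nat option) \<Rightarrow> nat list \<Rightarrow> nat \<Rightarrow> bool" where
  "seed_at n star w i \<longleftrightarrow> i < length w \<and>
     run n (\<lambda>a b. star b a) (w ! i) (rev (take i w)) \<noteq> None \<and>
     run n star (w ! i) (drop (Suc i) w) \<noteq> None"

text \<open>From the first seed, the run to the left ends in a letter \<R>-related to the whole word
  and the run to the right in one \<L>-related to it.\<close>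

definition answer :: "nat \<Rightarrow> (nat \<Rightarrow> nat \<Rightarrow> nat option) \<Rightarrow> nat list \<Rightarrow> (nat \<times> nat) option" where
  "answer n star w =
     (if \<exists>i. seed_at n star w i
      then let i = LEAST i. seed_at n star w i in
        Some (the (run n (\<lambda>a b. star b a) (w ! i) (rev (take i w))),
              the (run n star (w ! i) (drop (Suc i) w)))
      else None)"

context biorder begin

lemma seed_at_iff:
  assumes "w \<in> words"
  shows "seed_at n star w i \<longleftrightarrow> i < length w \<and> fixl (take i w) (w ! i) \<and> fixr (w ! i) (drop (Suc i) w)"
proof (cases "i < length w")
  case True
  then have "w ! i < n" using assms by (auto simp: in_lists_conv_set)
  moreover have "take i w \<in> words" "drop (Suc i) w \<in> words"
    using assms by (auto simp: in_lists_conv_set dest: in_set_takeD in_set_dropD)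
  ultimately show ?thesis using True by (simp only: seed_at_def run_iff run_left_iff)
qed (simp add: seed_at_def)

lemma ex_seed_at:
  assumes "w \<in> words"
  shows "(\<exists>i. seed_at n star w i) \<longleftrightarrow> seeded w"
proof
  assume "\<exists>i. seed_at n star w i"
  then obtain i where "i < length w" "fixl (take i w) (w ! i)" "fixr (w ! i) (drop (Suc i) w)"
    using seed_at_iff[OF assms] by blast
  then show "seeded w" using seededI[of "take i w" "w ! i" "drop (Suc i) w"] assms
    by (simp add: id_take_nth_drop[symmetric])
next
  assume "seeded w"
  then obtain u h v where "w = u @ h # v" "fixl u h" "fixr h v" by (auto simp: seeded_def)
  then have "seed_at n star w (length u)" unfolding seed_at_iff[OF assms] by simp
  then show "\<exists>i. seed_at n star w i" ..
qed

lemma answer_correct: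
  assumes "w \<in> words"
  shows "answer n star w \<noteq> None \<longleftrightarrow> regular_element IG (ig_mult n star) (elt w)"
    "answer n star w = Some (e, f) \<Longrightarrow> e < n \<and> f < n \<and>
       green_R IG (ig_mult n star) (elt [e]) (elt w) \<and> green_L IG (ig_mult n star) (elt w) (elt [f])"
proof -
  show "answer n star w \<noteq> None \<longleftrightarrow> regular_element IG (ig_mult n star) (elt w)"
    unfolding regular_iff_seeded[OF assms] ex_seed_at[OF assms, symmetric]
    by (simp add: answer_def Let_def)
  assume a: "answer n star w = Some (e, f)"
  define i where "i = (LEAST i. seed_at n star w i)"
  have ex: "\<exists>i. seed_at n star w i" using a by (auto simp: answer_def split: if_splits)
  then have i: "seed_at n star w i" unfolding i_def by (rule LeastI_ex)
  from ex have a': "answer n star w =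
    Some (the (run n (\<lambda>a b. star b a) (w ! i) (rev (take i w))),
          the (run n star (w ! i) (drop (Suc i) w)))"
    by (simp only: answer_def i_def Let_def if_True)
  have "Some e = run n (\<lambda>a b. star b a) (w ! i) (rev (take i w))"
    "Some f = run n star (w ! i) (drop (Suc i) w)"
    using a i unfolding a' by (auto simp: seed_at_def)
  moreover have "w = take i w @ w ! i # drop (Suc i) w"
    using i by (intro id_take_nth_drop) (simp add: seed_at_def)
  moreover have "fixl (take i w) (w ! i)" "fixr (w ! i) (drop (Suc i) w)"
    using i seed_at_iff[OF assms] by auto
  ultimately have "e < n" "f < n" "leR [e] w" "leR w [e]" "leL [f] w" "leL w [f]"
    using seed_R[of "w ! i" "take i w" e "drop (Suc i) w"]
      seed_L[of "w ! i" "drop (Suc i) w" f "take i w"] assms by simp_all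
  then show "e < n \<and> f < n \<and> green_R IG (ig_mult n star) (elt [e]) (elt w) \<and>
    green_L IG (ig_mult n star) (elt w) (elt [f])"
    using green_R_if_leR green_L_if_leL by blast
qed

end

section \<open>Computability\<close>

text \<open>Total recursive functions of arity \<open>k\<close>, phrased on argument lists so that
  closure rules follow the syntax of a term and no program has to be written out.\<close>

definition rec_fn :: "nat \<Rightarrow> (nat list \<Rightarrow> nat) \<Rightarrow> bool" where
  "rec_fn k f \<longleftrightarrow> (\<exists>r. \<forall>xs. length xs = k \<longrightarrow> rec_eval r xs = Some (f xs))"

lemma rec_fn_cong: "(\<And>xs. length xs = k \<Longrightarrow> f xs = g xs) \<Longrightarrow> rec_fn k f \<longleftrightarrow> rec_fn k g"
  by (simp add: rec_fn_def)

lemma rec_fn_nth: "i < k \<Longrightarrow> rec_fn k (\<lambda>xs. xs ! i)"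
  unfolding rec_fn_def by (rule exI[of _ "Proj i"]) simp

lemma rec_fn_Comp:
  assumes "rec_fn l f" "\<And>i. i < l \<Longrightarrow> rec_fn k (g i)"
  shows "rec_fn k (\<lambda>xs. f (map (\<lambda>i. g i xs) [0..<l]))"
proof -
  obtain r where r: "\<And>xs. length xs = l \<Longrightarrow> rec_eval r xs = Some (f xs)"
    using assms(1) by (auto simp: rec_fn_def)
  from assms(2) obtain R where
    R: "\<And>i xs. i < l \<Longrightarrow> length xs = k \<Longrightarrow> rec_eval (R i) xs = Some (g i xs)"
    unfolding rec_fn_def by metis
  have "rec_eval (Comp r (map R [0..<l])) xs = Some (f (map (\<lambda>i. g i xs) [0..<l]))"
    if "length xs = k" for xs
  proof -
    have "map (\<lambda>q. rec_eval q xs) (map R [0..<l]) = map (\<lambda>i. Some (g i xs)) [0..<l]"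
      using R that by simp
    then show ?thesis using r[of "map (\<lambda>i. g i xs) [0..<l]"]
      by (simp del: map_map add: comp_def Let_def) (auto simp: comp_def)
  qed
  then show ?thesis unfolding rec_fn_def by blast
qed

text \<open>Keeps parameters available under recursion and search, which put their own variables in
  front.\<close>

lemma rec_fn_tl:
  assumes "rec_fn k f"
  shows "rec_fn (Suc k) (\<lambda>xs. f (tl xs))"
proof -
  have "rec_fn (Suc k) (\<lambda>xs. f (map (\<lambda>i. xs ! Suc i) [0..<k]))"
    by (rule rec_fn_Comp[OF assms]) (simp add: rec_fn_nth)
  moreover have "map (\<lambda>i. xs ! Suc i) [0..<k] = tl xs" if "length xs = Suc k" for xs :: "nat list"
    using that by (intro nth_equalityI) (auto simp: nth_tl)
  then have "rec_fn (Suc k) (\<lambda>xs. f (map (\<lambda>i. xs ! Suc i) [0..<k])) \<longleftrightarrow> rec_fn (Suc k) (\<lambda>xs. f (tl xs))"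
    by (intro rec_fn_cong) simp
  ultimately show ?thesis by blast
qed

lemma rec_fn_0: "rec_fn k (\<lambda>xs. 0)"
  unfolding rec_fn_def by (rule exI[of _ Zero]) simp

lemma rec_fn_Suc: "rec_fn k f \<Longrightarrow> rec_fn k (\<lambda>xs. Suc (f xs))"
proof -
  assume f: "rec_fn k f"
  have "rec_fn 1 (\<lambda>xs. Suc (xs ! 0))"
    unfolding rec_fn_def by (rule exI[of _ Succ]) (auto simp: length_Suc_conv)
  from rec_fn_Comp[OF this, of k "\<lambda>_. f"] f show ?thesis by simp
qed

lemma rec_fn_const: "rec_fn k (\<lambda>xs. c)"
  by (induction c) (auto intro: rec_fn_0 rec_fn_Suc)

lemma rec_fn_rec_nat:
  assumes "rec_fn k a" "rec_fn k b" "rec_fn (Suc (Suc k)) (\<lambda>ys. g (ys ! 0) (ys ! 1) (tl (tl ys)))"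
  shows "rec_fn k (\<lambda>xs. rec_nat (a xs) (\<lambda>i r. g i r xs) (b xs))"
proof -
  obtain ra where ra: "\<And>xs. length xs = k \<Longrightarrow> rec_eval ra xs = Some (a xs)"
    using assms(1) by (auto simp: rec_fn_def)
  obtain rg where "\<forall>ys. length ys = Suc (Suc k) \<longrightarrow>
      rec_eval rg ys = Some (g (ys ! 0) (ys ! 1) (tl (tl ys)))"
    using assms(3) unfolding rec_fn_def by blast
  then have rg: "rec_eval rg (i # v # xs) = Some (g i v xs)" if "length xs = k" for i v xs
    using that by simp
  have "rec_eval (PrimRec ra rg) (c # xs) = Some (rec_nat (a xs) (\<lambda>i r. g i r xs) c)"
    if "length xs = k" for c xs
    using ra[OF that] rg[OF that] by (induction c) auto
  then have "rec_eval (PrimRec ra rg) ys = Some (rec_nat (a (tl ys)) (\<lambda>i r. g i r (tl ys)) (hd ys))"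
    if "length ys = Suc k" for ys
    using that by (cases ys) auto
  then have 1: "rec_fn (Suc k) (\<lambda>ys. rec_nat (a (tl ys)) (\<lambda>i r. g i r (tl ys)) (hd ys))"
    unfolding rec_fn_def by blast
  \<comment> \<open>The arguments for a composition: \<open>PrimRec\<close> recurses on its first
    argument, so the bound \<open>b xs\<close> is placed before the unchanged parameters.\<close>
  define G where "G = (\<lambda>i xs. case i of 0 \<Rightarrow> b xs | Suc j \<Rightarrow> xs ! j)"
  have "rec_fn k (G i)" if "i < Suc k" for i
    using that assms(2) by (cases i) (auto simp: G_def intro: rec_fn_nth)
  note 2 = rec_fn_Comp[OF 1, of k G, OF this]
  have "map (\<lambda>i. G i xs) [0..<Suc k] = b xs # xs" if "length xs = k" for xs
    using that by (intro nth_equalityI) (auto simp: G_def nth_Cons simp del: upt_Suc)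
  then have "rec_fn k (\<lambda>xs. rec_nat (a (tl (map (\<lambda>i. G i xs) [0..<Suc k])))
        (\<lambda>i r. g i r (tl (map (\<lambda>i. G i xs) [0..<Suc k]))) (hd (map (\<lambda>i. G i xs) [0..<Suc k]))) \<longleftrightarrow>
      rec_fn k (\<lambda>xs. rec_nat (a xs) (\<lambda>i r. g i r xs) (b xs))"
    by (intro rec_fn_cong) (simp only: list.sel)
  then show ?thesis using 2 by blast
qed

lemma rec_fn_Least_0:
  assumes "rec_fn (Suc k) (\<lambda>ys. f (ys ! 0) (tl ys))" "\<And>xs. length xs = k \<Longrightarrow> \<exists>y. f y xs = 0"
  shows "rec_fn k (\<lambda>xs. LEAST y. f y xs = 0)"
proof -
  obtain r where "\<forall>ys. length ys = Suc k \<longrightarrow> rec_eval r ys = Some (f (ys ! 0) (tl ys))"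
    using assms(1) unfolding rec_fn_def by blast
  then have r: "rec_eval r (y # xs) = Some (f y xs)" if "length xs = k" for y xs
    using that by simp
  have "rec_eval (Mu r) xs = Some (LEAST y. f y xs = 0)" if k: "length xs = k" for xs
  proof -
    have "f (LEAST y. f y xs = 0) xs = 0" using assms(2)[OF k] by (rule LeastI_ex)
    moreover have "\<exists>v. f z xs = Suc v" if "z < (LEAST y. f y xs = 0)" for z
      using not_less_Least[OF that] not0_implies_Suc by blast
    ultimately show ?thesis using r[OF k] by auto
  qed
  then show ?thesis unfolding rec_fn_def by blast
qed

text \<open>Truth is coded by \<open>0\<close>, the value for which \<open>Mu\<close>
  searches.\<close>

definition rec_prop :: "nat \<Rightarrow> (nat list \<Rightarrow> bool) \<Rightarrow> bool" where
  "rec_prop k P \<longleftrightarrow> rec_fn k (\<lambda>xs. if P xs then 0 else 1)"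

section \<open>Arithmetic, case distinction and decidable predicates\<close>

lemma rec_fn_nth_tl: "Suc i < k \<Longrightarrow> rec_fn k (\<lambda>xs. tl xs ! i)"
  using rec_fn_tl[OF rec_fn_nth, of i "k - 1"] by simp

lemma rec_fn_nth_tl_tl: "Suc (Suc i) < k \<Longrightarrow> rec_fn k (\<lambda>xs. tl (tl xs) ! i)"
  using rec_fn_tl[OF rec_fn_nth_tl, of i "k - 1"] by simp

lemmas rec_fn_basic = rec_fn_nth rec_fn_nth_tl rec_fn_nth_tl_tl rec_fn_const rec_fn_Suc

lemma rec_fn_add: "rec_fn k f \<Longrightarrow> rec_fn k g \<Longrightarrow> rec_fn k (\<lambda>xs. f xs + g xs)"
proof -
  assume *: "rec_fn k f" "rec_fn k g"
  have "rec_fn k (\<lambda>xs. rec_nat (f xs) (\<lambda>i r. Suc r) (g xs))"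
    by (rule rec_fn_rec_nat[OF *, of "\<lambda>i r xs. Suc r"]) (simp add: rec_fn_basic)
  moreover have "rec_nat a (\<lambda>i r. Suc r) b = a + b" for a b :: nat by (induction b) auto
  ultimately show ?thesis by simp
qed

lemma rec_fn_pred: "rec_fn k f \<Longrightarrow> rec_fn k (\<lambda>xs. f xs - 1)"
proof -
  assume *: "rec_fn k f"
  have "rec_fn k (\<lambda>xs. rec_nat 0 (\<lambda>i r. i) (f xs))"
    by (rule rec_fn_rec_nat[OF _ *, of _ "\<lambda>i r xs. i"]) (simp_all add: rec_fn_basic)
  moreover have "rec_nat 0 (\<lambda>i r. i) b = b - 1" for b :: nat by (cases b) auto
  ultimately show ?thesis by simp
qed

lemma rec_fn_diff: "rec_fn k f \<Longrightarrow> rec_fn k g \<Longrightarrow> rec_fn k (\<lambda>xs. f xs - g xs)"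
proof -
  assume *: "rec_fn k f" "rec_fn k g"
  have "rec_fn k (\<lambda>xs. rec_nat (f xs) (\<lambda>i r. r - 1) (g xs))"
    by (rule rec_fn_rec_nat[OF *, of "\<lambda>i r xs. r - 1"]) (intro rec_fn_pred rec_fn_basic, simp)
  moreover have "rec_nat a (\<lambda>i r. r - 1) b = a - b" for a b :: nat by (induction b) auto
  ultimately show ?thesis by simp
qed

text \<open>A recursion of depth 0 or 1 selects the branch.\<close>

lemma rec_fn_if: "rec_prop k P \<Longrightarrow> rec_fn k f \<Longrightarrow> rec_fn k g \<Longrightarrow>
  rec_fn k (\<lambda>xs. if P xs then f xs else g xs)"
proof -
  assume *: "rec_prop k P" "rec_fn k f" "rec_fn k g"
  have "rec_fn k (\<lambda>xs. rec_nat (f xs) (\<lambda>i r. g xs) (if P xs then 0 else 1))"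
    by (rule rec_fn_rec_nat[OF *(2) *(1)[unfolded rec_prop_def], of "\<lambda>i r xs. g xs"])
      (intro rec_fn_tl *)
  moreover have "rec_nat a (\<lambda>i r. b) (if p then 0 else 1) = (if p then a else b)"
    for a b :: nat and p by simp
  ultimately show ?thesis by simp
qed

lemma rec_prop_eq_0: "rec_fn k f \<Longrightarrow> rec_prop k (\<lambda>xs. f xs = 0)"
proof -
  assume *: "rec_fn k f"
  have "rec_fn k (\<lambda>xs. rec_nat 0 (\<lambda>i r. 1) (f xs))"
    by (rule rec_fn_rec_nat[OF _ *, of _ "\<lambda>i r xs. 1"]) (rule rec_fn_basic)+
  moreover have "rec_nat 0 (\<lambda>i r. 1) b = (if b = 0 then 0 else 1::nat)" for b :: nat by (cases b) auto
  ultimately show ?thesis by (simp only: rec_prop_def)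
qed

lemma rec_prop_le: "rec_fn k f \<Longrightarrow> rec_fn k g \<Longrightarrow> rec_prop k (\<lambda>xs. f xs \<le> g xs)"
  using rec_prop_eq_0[OF rec_fn_diff[of k f g]] by simp

lemma rec_prop_less: "rec_fn k f \<Longrightarrow> rec_fn k g \<Longrightarrow> rec_prop k (\<lambda>xs. f xs < g xs)"
  using rec_prop_le[OF rec_fn_Suc[of k f], of g] by (simp add: Suc_le_eq)

lemma rec_prop_not: "rec_prop k P \<Longrightarrow> rec_prop k (\<lambda>xs. \<not> P xs)"
proof -
  assume "rec_prop k P"
  then have "rec_fn k (\<lambda>xs. if P xs then 1 else 0)" by (intro rec_fn_if rec_fn_const)
  then show ?thesis unfolding rec_prop_def by (subst rec_fn_cong) auto
qed

lemma rec_prop_and: "rec_prop k P \<Longrightarrow> rec_prop k Q \<Longrightarrow> rec_prop k (\<lambda>xs. P xs \<and> Q xs)"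
proof -
  assume *: "rec_prop k P" "rec_prop k Q"
  have "rec_fn k (\<lambda>xs. if P xs then (if Q xs then 0 else 1) else 1)"
    by (intro rec_fn_if rec_fn_const *)
  then show ?thesis unfolding rec_prop_def by (subst rec_fn_cong) auto
qed

lemma rec_prop_or: "rec_prop k P \<Longrightarrow> rec_prop k Q \<Longrightarrow> rec_prop k (\<lambda>xs. P xs \<or> Q xs)"
proof -
  assume *: "rec_prop k P" "rec_prop k Q"
  have "rec_fn k (\<lambda>xs. if P xs then 0 else (if Q xs then 0 else 1))"
    by (intro rec_fn_if rec_fn_const *)
  then show ?thesis unfolding rec_prop_def by (subst rec_fn_cong) auto
qed

lemma rec_prop_eq: "rec_fn k f \<Longrightarrow> rec_fn k g \<Longrightarrow> rec_prop k (\<lambda>xs. f xs = g xs)"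
  using rec_prop_and[OF rec_prop_le[of k f g] rec_prop_le[of k g f]] by (simp add: eq_iff)

lemma rec_fn_Least:
  assumes "rec_prop (Suc k) (\<lambda>ys. P (ys ! 0) (tl ys))" "\<And>xs. length xs = k \<Longrightarrow> \<exists>y. P y xs"
  shows "rec_fn k (\<lambda>xs. LEAST y. P y xs)"
proof -
  have "rec_fn k (\<lambda>xs. LEAST y. (if P y xs then 0 else 1::nat) = 0)"
    by (rule rec_fn_Least_0) (use assms in \<open>auto simp: rec_prop_def\<close>)
  moreover have "((if p then 0 else 1::nat) = 0) = p" for p by simp
  ultimately show ?thesis by simp
qed

lemmas rec_props = rec_prop_eq rec_prop_le rec_prop_less rec_prop_and rec_prop_or rec_prop_not

section \<open>Decoding pairs and lists\<close>

lemma rec_fn_triangle: "rec_fn k f \<Longrightarrow> rec_fn k (\<lambda>xs. triangle (f xs))"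
proof -
  assume *: "rec_fn k f"
  have "rec_fn k (\<lambda>xs. rec_nat 0 (\<lambda>i r. r + Suc i) (f xs))"
    by (rule rec_fn_rec_nat[OF rec_fn_const *, of "\<lambda>i r xs. r + Suc i"])
      (intro rec_fn_add rec_fn_Suc rec_fn_nth; simp)
  moreover have "rec_nat 0 (\<lambda>i r. r + Suc i) b = triangle b" for b by (induction b) auto
  ultimately show ?thesis by simp
qed

lemma rec_fn_prod_encode: "rec_fn k f \<Longrightarrow> rec_fn k g \<Longrightarrow> rec_fn k (\<lambda>xs. prod_encode (f xs, g xs))"
  unfolding prod_encode_def by (simp add: rec_fn_add rec_fn_triangle)

text \<open>The code of a pair \<open>(a, b)\<close> is \<open>triangle (a + b) + a\<close>, and \<open>a + b\<close> is recovered first.\<close>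

definition pair_sum :: "nat \<Rightarrow> nat" where
  "pair_sum c = (LEAST s. c < triangle (Suc s))"

text \<open>Since \<open>a \<le> a + b\<close>, the code lies between the triangular numbers of
  \<open>a + b\<close> and of its successor.\<close>

lemma pair_sum_prod_encode: "pair_sum (prod_encode (a, b)) = a + b"
  unfolding pair_sum_def
proof (rule Least_equality)
  show "prod_encode (a, b) < triangle (Suc (a + b))" by (simp add: prod_encode_def)
  fix s assume "prod_encode (a, b) < triangle (Suc s)"
  moreover have "triangle (Suc s) \<le> triangle (a + b)" if "Suc s \<le> a + b"
    using that unfolding triangle_def by (intro div_le_mono mult_le_mono) auto
  ultimately show "a + b \<le> s" by (fastforce simp: prod_encode_def not_less_eq_eq)
qed

lemma less_triangle_Suc: "c < triangle (Suc c)"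
  by simp

lemma rec_fn_pair_sum: "rec_fn k f \<Longrightarrow> rec_fn k (\<lambda>xs. pair_sum (f xs))"
  unfolding pair_sum_def
proof (rule rec_fn_Least)
  show "\<exists>s. f xs < triangle (Suc s)" for xs using less_triangle_Suc by blast
qed (intro rec_props rec_fn_triangle rec_fn_Suc rec_fn_nth rec_fn_tl; simp)

lemma fst_prod_decode: "fst (prod_decode c) = c - triangle (pair_sum c)"
proof -
  obtain a b where "c = prod_encode (a, b)" by (metis prod_decode_inverse surj_pair)
  then show ?thesis by (simp add: pair_sum_prod_encode) (simp add: prod_encode_def)
qed

lemma snd_prod_decode: "snd (prod_decode c) = pair_sum c - fst (prod_decode c)"
proof -
  obtain a b where "c = prod_encode (a, b)" by (metis prod_decode_inverse surj_pair)
  then show ?thesis by (simp add: pair_sum_prod_encode)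
qed

lemma rec_fn_fst_decode: "rec_fn k f \<Longrightarrow> rec_fn k (\<lambda>xs. fst (prod_decode (f xs)))"
  unfolding fst_prod_decode by (intro rec_fn_diff rec_fn_triangle rec_fn_pair_sum)

lemma rec_fn_snd_decode: "rec_fn k f \<Longrightarrow> rec_fn k (\<lambda>xs. snd (prod_decode (f xs)))"
  unfolding snd_prod_decode by (intro rec_fn_diff rec_fn_fst_decode rec_fn_pair_sum)

text \<open>A nonempty list is coded by the successor of the pair of head and tail. The empty list
  has code \<open>0\<close> and stays its own tail, because \<open>0 - 1 = 0\<close> decodes to
  \<open>(0, 0)\<close>.\<close>

definition drop_code :: "nat \<Rightarrow> nat \<Rightarrow> nat" where
  "drop_code i c = rec_nat c (\<lambda>_ r. snd (prod_decode (r - 1))) i"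

definition nth_code :: "nat \<Rightarrow> nat \<Rightarrow> nat" where
  "nth_code c i = fst (prod_decode (drop_code i c - 1))"

definition length_code :: "nat \<Rightarrow> nat" where
  "length_code c = (LEAST i. drop_code i c = 0)"

lemma prod_decode_0: "prod_decode 0 = (0, 0)"
  by (simp add: prod_decode_def prod_decode_aux.simps)

lemma list_encode_eq_0_iff [simp]: "list_encode xs = 0 \<longleftrightarrow> xs = []"
  by (cases xs) auto

lemma drop_code: "drop_code i (list_encode xs) = list_encode (drop i xs)"
proof (induction i)
  case (Suc i)
  have "snd (prod_decode (list_encode ys - 1)) = list_encode (tl ys)" for ys
    by (cases ys) (auto simp: prod_decode_0)
  then show ?case using Suc by (simp add: drop_code_def drop_Suc tl_drop)
qed (simp add: drop_code_def)

lemma nth_code: "nth_code (list_encode xs) i = (if i < length xs then xs ! i else 0)"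
proof (cases "i < length xs")
  case True
  then have "drop i xs = xs ! i # drop (Suc i) xs" by (simp add: Cons_nth_drop_Suc)
  then show ?thesis using True by (simp add: nth_code_def drop_code)
qed (simp add: nth_code_def drop_code prod_decode_0)

lemma length_code: "length_code (list_encode xs) = length xs"
  unfolding length_code_def drop_code by (rule Least_equality) auto

lemma rec_fn_drop_code: "rec_fn k f \<Longrightarrow> rec_fn k g \<Longrightarrow> rec_fn k (\<lambda>xs. drop_code (f xs) (g xs))"
  unfolding drop_code_def
  by (rule rec_fn_rec_nat, assumption+) (intro rec_fn_snd_decode rec_fn_pred rec_fn_nth; simp)

lemma rec_fn_nth_code: "rec_fn k f \<Longrightarrow> rec_fn k g \<Longrightarrow> rec_fn k (\<lambda>xs. nth_code (f xs) (g xs))"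
  unfolding nth_code_def by (intro rec_fn_fst_decode rec_fn_pred rec_fn_drop_code)

lemma rec_fn_length_code: "rec_fn k f \<Longrightarrow> rec_fn k (\<lambda>xs. length_code (f xs))"
  unfolding length_code_def
proof (rule rec_fn_Least)
  fix xs
  obtain ys where "f xs = list_encode ys" by (metis list_decode_inverse)
  then have "drop_code (length ys) (f xs) = 0" by (simp add: drop_code)
  then show "\<exists>i. drop_code i (f xs) = 0" ..
qed (intro rec_prop_eq_0 rec_fn_drop_code rec_fn_basic rec_fn_tl; simp)

section \<open>The decision procedure on codes\<close>

fun option_code :: "nat option \<Rightarrow> nat" where
  "option_code None = 0"
| "option_code (Some k) = Suc k"

text \<open>The switch \<open>d\<close> selects between runs to the right over \<open>\<E>\<close> (\<open>d = 0\<close>) and runs to the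
  left, which are runs over the dual of \<open>\<E>\<close>.\<close>

definition entry_code :: "nat \<Rightarrow> nat \<Rightarrow> nat \<Rightarrow> nat \<Rightarrow> nat" where
  "entry_code d T i j =
     (if d = 0 then nth_code (nth_code T i) j else nth_code (nth_code T j) i)"

text \<open>The disjunct \<open>length_code T \<le> h\<close> makes the search total; hitting that
  bound means that there is no candidate.\<close>

definition step_code :: "nat \<Rightarrow> nat \<Rightarrow> nat \<Rightarrow> nat \<Rightarrow> nat" where
  "step_code d T k e =
     (let h = LEAST h. length_code T \<le> h \<or>
        (entry_code d T k h = Suc k \<and> entry_code d T h k = Suc h \<and> entry_code d T e h = Suc h)
      in if h < length_code T then entry_code d T h e else 0)"

text \<open>The accumulator is \<open>0\<close> after a breakdown and otherwise the successor of the
  current state. A run to the left reads positions \<open>i - 1\<close>, \<open>i - 2\<close> and so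
  on.\<close>

definition run_code :: "nat \<Rightarrow> nat \<Rightarrow> nat \<Rightarrow> nat \<Rightarrow> nat" where
  "run_code d T w i =
     rec_nat (Suc (nth_code w i))
       (\<lambda>j r. if r = 0 then 0
              else step_code d T (r - 1) (nth_code w (if d = 0 then Suc i + j else i - Suc j)))
       (if d = 0 then length_code w - Suc i else i)"

definition answer_code :: "nat \<Rightarrow> nat \<Rightarrow> nat" where
  "answer_code T w =
     (let i = LEAST i. length_code w \<le> i \<or> (\<not> run_code 1 T w i = 0 \<and> \<not> run_code 0 T w i = 0)
      in if i < length_code w
         then Suc (prod_encode (run_code 1 T w i - 1, run_code 0 T w i - 1)) else 0)"

lemma rec_fn_entry_code:
  "rec_fn k d \<Longrightarrow> rec_fn k f \<Longrightarrow> rec_fn k g \<Longrightarrow> rec_fn k h \<Longrightarrow>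
    rec_fn k (\<lambda>xs. entry_code (d xs) (f xs) (g xs) (h xs))"
  unfolding entry_code_def by (intro rec_fn_if rec_prop_eq_0 rec_fn_nth_code)

lemma rec_fn_step_code:
  assumes "rec_fn k d" "rec_fn k f" "rec_fn k g" "rec_fn k h"
  shows "rec_fn k (\<lambda>xs. step_code (d xs) (f xs) (g xs) (h xs))"
proof -
  note tls = assms[THEN rec_fn_tl]
  have "rec_fn k (\<lambda>xs. LEAST y. length_code (f xs) \<le> y \<or>
        (entry_code (d xs) (f xs) (g xs) y = Suc (g xs) \<and>
         entry_code (d xs) (f xs) y (g xs) = Suc y \<and> entry_code (d xs) (f xs) (h xs) y = Suc y))"
  proof (rule rec_fn_Least)
    show "\<exists>y. length_code (f xs) \<le> y \<or>
        (entry_code (d xs) (f xs) (g xs) y = Suc (g xs) \<and>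
         entry_code (d xs) (f xs) y (g xs) = Suc y \<and> entry_code (d xs) (f xs) (h xs) y = Suc y)" for xs
      by blast
  qed (intro rec_props rec_fn_length_code rec_fn_entry_code rec_fn_Suc tls rec_fn_nth; simp)
  then show ?thesis
    unfolding step_code_def Let_def
    by (intro rec_fn_if rec_props rec_fn_length_code rec_fn_entry_code assms rec_fn_const)
qed

lemma rec_fn_run_code:
  assumes "rec_fn k d" "rec_fn k f" "rec_fn k g" "rec_fn k h"
  shows "rec_fn k (\<lambda>xs. run_code (d xs) (f xs) (g xs) (h xs))"
  unfolding run_code_def
proof (rule rec_fn_rec_nat)
  note tls = assms[THEN rec_fn_tl, THEN rec_fn_tl]
  show "rec_fn (Suc (Suc k)) (\<lambda>ys. if ys ! 1 = 0 then 0
     else step_code (d (tl (tl ys))) (f (tl (tl ys))) (ys ! 1 - 1)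
            (nth_code (g (tl (tl ys)))
               (if d (tl (tl ys)) = 0 then Suc (h (tl (tl ys))) + ys ! 0 else h (tl (tl ys)) - Suc (ys ! 0))))"
    by (intro rec_fn_if rec_prop_eq_0 rec_fn_step_code rec_fn_nth_code rec_fn_pred rec_fn_add
        rec_fn_diff rec_fn_Suc rec_fn_nth tls rec_fn_const; simp)
qed (intro rec_fn_if rec_prop_eq_0 rec_fn_nth_code rec_fn_length_code rec_fn_diff rec_fn_Suc assms)+

lemma rec_fn_answer_code: "rec_fn 2 (\<lambda>xs. answer_code (xs ! 0) (xs ! 1))"
proof -
  have L: "rec_fn 2 (\<lambda>xs. LEAST i. length_code (xs ! 1) \<le> i \<or>
      (\<not> run_code 1 (xs ! 0) (xs ! 1) i = 0 \<and> \<not> run_code 0 (xs ! 0) (xs ! 1) i = 0))"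
  proof (rule rec_fn_Least)
    show "\<exists>i. length_code (xs ! 1) \<le> i \<or>
      (\<not> run_code 1 (xs ! 0) (xs ! 1) i = 0 \<and> \<not> run_code 0 (xs ! 0) (xs ! 1) i = 0)" for xs
      by blast
  qed (intro rec_props rec_fn_length_code rec_fn_run_code rec_fn_const rec_fn_nth rec_fn_nth_tl; simp)
  show ?thesis
    unfolding answer_code_def Let_def
    by (intro rec_fn_if rec_props rec_fn_Suc rec_fn_prod_encode rec_fn_pred rec_fn_length_code
        rec_fn_run_code L rec_fn_const rec_fn_nth; simp)
qed

subsection \<open>Correctness\<close>

abbreviation switch :: "nat \<Rightarrow> (nat \<Rightarrow> nat \<Rightarrow> nat option) \<Rightarrow> nat \<Rightarrow> nat \<Rightarrow> nat option" where
  "switch d star \<equiv> (if d = 0 then star else (\<lambda>a b. star b a))"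

context biorder begin

lemma length_code_table: "length_code (encode_table n star) = n"
  by (simp add: encode_table_def length_code)

lemma entry_code: "entry_code d (encode_table n star) i j = option_code (switch d star i j)"
proof -
  have *: "nth_code (nth_code (encode_table n star) i) j = option_code (star i j)" for i j
  proof (cases "i < n \<and> j < n")
    case True
    then show ?thesis by (auto simp: encode_table_def nth_code split: option.split)
  next
    case False
    \<comment> \<open>A row index out of range decodes to \<open>0\<close>, which is an empty row;
      either way the entry read is \<open>0\<close>, the code of an undefined product.\<close>
    moreover have "nth_code 0 j = 0" using nth_code[of "[]" j] by simp
    ultimately show ?thesis
      by (auto simp: encode_table_def nth_code biorder_op_def idem)
  qed
  show ?thesis by (simp add: entry_code_def *)
qed

text \<open>Candidates are letters, so the bounded search stops at the least candidate if there is
  one and at \<open>n\<close> otherwise.\<close>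

lemma step_code:
  "step_code d (encode_table n star) k e = option_code (run_step n (switch d star) k e)"
proof -
  have oc: "option_code x = Suc y \<longleftrightarrow> x = Some y" for x y by (cases x) auto
  let ?s = "switch d star"
  have lt: "h < n" if "candidate ?s k e h" for h
    using that by (auto simp: candidate_def star_iff split: if_splits)
  define P where "P = (\<lambda>h. n \<le> h \<or> candidate ?s k e h)"
  have P: "step_code d (encode_table n star) k e =
      (if (LEAST h. P h) < n then option_code (?s (LEAST h. P h) e) else 0)"
    unfolding step_code_def length_code_table entry_code oc Let_def P_def candidate_def by simp
  show ?thesis
  proof (cases "\<exists>h. candidate ?s k e h")
    case True
    define l where "l = (LEAST h. candidate ?s k e h)"
    have l: "candidate ?s k e l" unfolding l_def using True by (rule LeastI_ex)
    have "(LEAST h. P h) = l"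
    proof (rule Least_equality)
      show "P l" using l by (simp add: P_def)
      fix h assume "P h"
      then show "l \<le> h" using lt[OF l] by (auto simp: P_def l_def intro: Least_le)
    qed
    then show ?thesis using P lt[OF l] l unfolding run_step_def l_def[symmetric] by auto
  next
    case False
    then have "(LEAST h. P h) = n" by (intro Least_equality) (auto simp: P_def)
    then show ?thesis using P False by (auto simp: run_step_def)
  qed
qed

text \<open>Induction on the number \<open>j\<close> of letters read: after \<open>j\<close> rounds
  the accumulator codes the run along \<open>take j x\<close>, where \<open>x\<close> is the word in
  reading order.\<close>

lemma run_code:
  assumes "i < length w"
  shows "run_code d (encode_table n star) (list_encode w) i =
    option_code (run n (switch d star) (w ! i) (if d = 0 then drop (Suc i) w else rev (take i w)))"
proof -
  define x where "x = (if d = 0 then drop (Suc i) w else rev (take i w))"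
  define idx where "idx = (\<lambda>j. if d = 0 then Suc i + j else i - Suc j)"
  define F where "F = (\<lambda>j r. if r = 0 then 0
    else step_code d (encode_table n star) (r - 1) (nth_code (list_encode w) (idx j)))"
  have nth: "nth_code (list_encode w) (idx j) = x ! j" if "j < length x" for j
    using that assms by (auto simp: x_def idx_def nth_code rev_nth)
  have "rec_nat (Suc (w ! i)) F j = option_code (run n (switch d star) (w ! i) (take j x))"
    if "j \<le> length x" for j
    using that
  proof (induction j)
    case (Suc j)
    then have t: "take (Suc j) x = take j x @ [x ! j]" by (simp add: take_Suc_conv_app_nth)
    show ?case unfolding t run_snoc using Suc nth[of j]
      by (cases "run n (switch d star) (w ! i) (take j x)") (auto simp: F_def step_code)
  qed simp
  from this[of "length x"]
  have "rec_nat (Suc (w ! i)) F (length x) = option_code (run n (switch d star) (w ! i) x)" by simp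
  moreover have "length x = (if d = 0 then length w - Suc i else i)" using assms by (simp add: x_def)
  moreover have "run_code d (encode_table n star) (list_encode w) i =
      rec_nat (Suc (w ! i)) F (if d = 0 then length w - Suc i else i)"
    unfolding run_code_def F_def idx_def length_code using nth_code[of w i] assms by (simp only: if_True)
  ultimately show ?thesis by (simp only: x_def)
qed

lemma answer_code: "answer_code (encode_table n star) (list_encode w) = encode_answer (answer n star w)"
proof -
  have oc: "option_code x = 0 \<longleftrightarrow> x = None" "0 < option_code x \<longleftrightarrow> x \<noteq> None" for x
    by (cases x; simp)+
  let ?r = "\<lambda>d i. run_code d (encode_table n star) (list_encode w) i"
  define P where "P = (\<lambda>i. length w \<le> i \<or> (\<not> ?r 1 i = 0 \<and> \<not> ?r 0 i = 0))"
  have P: "P i \<longleftrightarrow> length w \<le> i \<or> seed_at n star w i" for i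
    using run_code[of i w] by (auto simp: P_def seed_at_def oc not_le)
  have eq: "answer_code (encode_table n star) (list_encode w) =
      (if (LEAST i. P i) < length w
       then Suc (prod_encode (?r 1 (LEAST i. P i) - 1, ?r 0 (LEAST i. P i) - 1)) else 0)"
    unfolding answer_code_def length_code Let_def P_def by simp
  show ?thesis
  proof (cases "\<exists>i. seed_at n star w i")
    case True
    define l where "l = (LEAST i. seed_at n star w i)"
    have l: "seed_at n star w l" unfolding l_def using True by (rule LeastI_ex)
    then have lw: "l < length w" by (simp add: seed_at_def)
    have "(LEAST i. P i) = l"
    proof (rule Least_equality)
      show "P l" using l by (simp add: P)
      fix i assume "P i"
      then show "l \<le> i" using lw by (auto simp: P l_def intro: Least_le)
    qed
    moreover have "answer n star w =
      Some (the (run n (\<lambda>a b. star b a) (w ! l) (rev (take l w))), the (run n star (w ! l) (drop (Suc l) w)))"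
      using True unfolding answer_def l_def by (simp only: Let_def if_True)
    ultimately show ?thesis using eq lw l run_code[OF lw] by (auto simp: seed_at_def)
  next
    case False
    then have "(LEAST i. P i) = length w" by (intro Least_equality) (auto simp: P)
    then show ?thesis using eq False by (simp add: answer_def)
  qed
qed

end

theorem theorem3p7:
  shows "\<exists>alg :: recf. \<forall>(n :: nat) (star :: nat \<Rightarrow> nat \<Rightarrow> nat option) (w :: nat list).
    finite_biordered_set n star \<longrightarrow> w \<in> lists {..<n} \<longrightarrow>
    (\<exists>ans :: (nat \<times> nat) option.
       rec_eval alg [encode_table n star, list_encode w] = Some (encode_answer ans) \<and>
       (ans \<noteq> None \<longleftrightarrow>
          regular_element (ig_carrier n star) (ig_mult n star) (ig_class n star w)) \<and>
       (\<forall>e f. ans = Some (e, f) \<longrightarrow>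
          e < n \<and> f < n \<and>
          green_R (ig_carrier n star) (ig_mult n star) (ig_class n star [e]) (ig_class n star w) \<and>
          green_L (ig_carrier n star) (ig_mult n star) (ig_class n star w) (ig_class n star [f])))"
proof -
  obtain alg where alg: "\<And>xs. length xs = 2 \<Longrightarrow> rec_eval alg xs = Some (answer_code (xs ! 0) (xs ! 1))"
    using rec_fn_answer_code by (auto simp: rec_fn_def)
  show ?thesis
  proof (intro exI[of _ alg] allI impI)
    fix n star w
    assume "finite_biordered_set n star" and w: "w \<in> lists {..<n}"
    then obtain S m where S: "semigroup_on S m" "idempotents S m = {..<n}" and star: "star = biorder_op S m"
      by (auto simp: finite_biordered_set_def)
    \<comment> \<open>The semigroup behind the biordered set enters only the correctness argument;
      \<open>alg\<close> has been fixed before it.\<close>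
    interpret biorder S m n by unfold_locales (fact S)+
    have "rec_eval alg [encode_table n star, list_encode w] = Some (encode_answer (answer n star w))"
      using alg[of "[encode_table n star, list_encode w]"] by (simp add: star answer_code)
    then show "\<exists>ans. rec_eval alg [encode_table n star, list_encode w] = Some (encode_answer ans) \<and>
       (ans \<noteq> None \<longleftrightarrow>
          regular_element (ig_carrier n star) (ig_mult n star) (ig_class n star w)) \<and>
       (\<forall>e f. ans = Some (e, f) \<longrightarrow>
          e < n \<and> f < n \<and>
          green_R (ig_carrier n star) (ig_mult n star) (ig_class n star [e]) (ig_class n star w) \<and>
          green_L (ig_carrier n star) (ig_mult n star) (ig_class n star w) (ig_class n star [f]))"
      using answer_correct[OF w] unfolding star by blast
  qed
qed

end
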